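(* Let $A$ be a commutative associative superalgebra with parity $p$. The $\mathbb Z_+$-graded superspace $\mathcal P(A)=\bigoplus_{k=0}^\infty\mathcal P_k(A)$, where $\mathcal P_k(A)=W^{\mathrm{as}}_{k-1}(A)$, together with the concatenation product $\cdot:\mathcal P_h(A)\times\mathcal P_{k-h}(A)\to\mathcal P_k(A)$ given by $$(X\cdot Y)(a_1,\dots,a_k)=\sum_{\substack{i_1<\dots<i_h\\ i_{h+1}<\dots<i_k}}\epsilon_a(i_1,\dots,i_k)(-1)^{p(Y)(p(a_{i_1})+\dots+p(a_{i_h}))}X(a_{i_1},\dots,a_{i_h})Y(a_{i_{h+1}},\dots,a_{i_k}),$$ and with the Lie superalgebra bracket on $\mathcal P(A)=W^{\mathrm{as}}(A)$, is a Poisson superalgebra.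
   Context: All spaces are over a field $\mathbb F$ of characteristic $0$. Universal Lie superalgebra of a superspace $A$ with parity $p$: $W(A)=\bigoplus_{k\ge-1}W_k(A)$, $W_k(A)=\mathrm{Hom}(S^{k+1}(A),A)$ (supersymmetric $(k+1)$-linear maps), with induced parity $p$. For $X\in W_h(A)$, $Y\in W_{k-h}(A)$ put $$(X\Box Y)(v_0,\dots,v_k)=\sum_{\substack{i_0<\dots<i_{k-h}\\ i_{k-h+1}<\dots<i_k}}\epsilon_v(i_0,\dots,i_k)X(Y(v_{i_0},\dots,v_{i_{k-h}}),v_{i_{k-h+1}},\dots,v_{i_k}),$$ the sum being over permutations of $(0,\dots,k)$, where $\epsilon_v(i_0,\dots,i_k)=(-1)^M$ with $M$ the number of interchanges of indices of odd $v_i$'s in the permutation. $[X,Y]=X\Box Y-(-1)^{p(X)p(Y)}Y\Box X$ is a Lie superalgebra bracket; for $Y\in W_{-1}(A)=A$, $[X,Y](v_1,\dots,v_k)=X(Y,v_1,\dots,v_k)$. $\mathrm{Der}(A)$ is the Lie superalgebra of linear maps $X:A\to A$ with $X(ab)=X(a)b+(-1)^{p(a)p(b)}X(b)a$. $W^{\mathrm{as}}(A)\subset W(A)$ is its full prolongation: $W^{\mathrm{as}}_{-1}(A)=A$, $W_0^{\mathrm{as}}(A)=\mathrm{Der}(A)$, $W_k^{\mathrm{as}}(A)=\{X\in W_k(A):[X,A]\subset W^{\mathrm{as}}_{k-1}(A)\}$ for $k\ge1$. In the product formula $X\in W^{\mathrm{as}}_{h-1}(A)$, $Y\in W^{\mathrm{as}}_{k-h-1}(A)$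 with $h\ge0$, $k-h\ge0$; the sum is over permutations of $(1,\dots,k)$ with the indicated inequalities; $\epsilon_a$ is computed with $a_i$ as elements of $A$ (parity $p$). A Poisson superalgebra is a commutative associative superalgebra with a Lie superalgebra bracket satisfying $[a,bc]=[a,b]c+(-1)^{p(a)p(b)}b[a,c]$. *)

theory Defs
  imports Complex_Main "HOL-Library.Z2" "HOL-Library.Function_Algebras"
    "HOL-Combinatorics.Permutations"
begin

section \<open>Superspaces and superalgebras\<close>

text \<open>
  Parities are elements of \<open>\<int>/2\<int>\<close>, rendered by the two-element field \<open>bit\<close>.
  All spaces are subsets \<open>V\<close> of an ambient vector space, with scalar multiplication
  \<open>scl\<close>; \<open>G 0\<close> and \<open>G 1\<close> are the even and the odd part.
\<close>

definition psign :: "bit \<Rightarrow> 'f::field" where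
  "psign p = (if p = 0 then 1 else -1)"

definition sum_of_subspaces :: "('i \<Rightarrow> 'v::ab_group_add set) \<Rightarrow> 'v set" where
  "sum_of_subspaces P = {(\<Sum>i\<in>I. x i) | I x. finite I \<and> (\<forall>i\<in>I. x i \<in> P i)}"

definition internal_direct_sum ::
    "('f::field \<Rightarrow> 'v::ab_group_add \<Rightarrow> 'v) \<Rightarrow> 'v set \<Rightarrow> ('i \<Rightarrow> 'v set) \<Rightarrow> bool" where
  "internal_direct_sum scl V P \<longleftrightarrow>
     (\<forall>i. module.subspace scl (P i)) \<and>
     V = sum_of_subspaces P \<and>
     (\<forall>I x. finite I \<longrightarrow> (\<forall>i\<in>I. x i \<in> P i) \<longrightarrow> (\<Sum>i\<in>I. x i) = 0 \<longrightarrow> (\<forall>i\<in>I. x i = 0))"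

definition superspace ::
    "('f::field \<Rightarrow> 'v::ab_group_add \<Rightarrow> 'v) \<Rightarrow> 'v set \<Rightarrow> (bit \<Rightarrow> 'v set) \<Rightarrow> bool" where
  "superspace scl V G \<longleftrightarrow> vector_space scl \<and> internal_direct_sum scl V G"

definition graded_superspace ::
    "('f::field \<Rightarrow> 'v::ab_group_add \<Rightarrow> 'v) \<Rightarrow> 'v set \<Rightarrow> (bit \<Rightarrow> 'v set) \<Rightarrow> (nat \<Rightarrow> 'v set) \<Rightarrow> bool" where
  "graded_superspace scl V G P \<longleftrightarrow>
     superspace scl V G \<and> internal_direct_sum scl V P \<and>
     (\<forall>k. superspace scl (P k) (\<lambda>p. G p \<inter> P k))"

definition part :: "(bit \<Rightarrow> 'v::ab_group_add set) \<Rightarrow> bit \<Rightarrow> 'v \<Rightarrow> 'v" where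
  "part G p x = (THE y. y \<in> G p \<and> x - y \<in> G (p + 1))"

definition superalgebra ::
    "('f::field \<Rightarrow> 'v::ab_group_add \<Rightarrow> 'v) \<Rightarrow> 'v set \<Rightarrow> (bit \<Rightarrow> 'v set) \<Rightarrow> ('v \<Rightarrow> 'v \<Rightarrow> 'v) \<Rightarrow> bool" where
  "superalgebra scl V G m \<longleftrightarrow>
     superspace scl V G \<and>
     (\<forall>x\<in>V. \<forall>y\<in>V. m x y \<in> V) \<and>
     (\<forall>x\<in>V. \<forall>y\<in>V. \<forall>z\<in>V. m (x + y) z = m x z + m y z \<and> m x (y + z) = m x y + m x z) \<and>
     (\<forall>c. \<forall>x\<in>V. \<forall>y\<in>V. m (scl c x) y = scl c (m x y) \<and> m x (scl c y) = scl c (m x y)) \<and>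
     (\<forall>p q. \<forall>x\<in>G p. \<forall>y\<in>G q. m x y \<in> G (p + q))"

text \<open>No unit element is required.\<close>

definition comm_assoc_superalgebra ::
    "('f::field \<Rightarrow> 'v::ab_group_add \<Rightarrow> 'v) \<Rightarrow> 'v set \<Rightarrow> (bit \<Rightarrow> 'v set) \<Rightarrow> ('v \<Rightarrow> 'v \<Rightarrow> 'v) \<Rightarrow> bool" where
  "comm_assoc_superalgebra scl V G m \<longleftrightarrow>
     superalgebra scl V G m \<and>
     (\<forall>x\<in>V. \<forall>y\<in>V. \<forall>z\<in>V. m (m x y) z = m x (m y z)) \<and>
     (\<forall>p q. \<forall>x\<in>G p. \<forall>y\<in>G q. m x y = scl (psign (p * q)) (m y x))"

definition lie_superalgebra ::
    "('f::field_char_0 \<Rightarrow> 'v::ab_group_add \<Rightarrow> 'v) \<Rightarrow> 'v set \<Rightarrow> (bit \<Rightarrow> 'v set) \<Rightarrow> ('v \<Rightarrow> 'v \<Rightarrow> 'v) \<Rightarrow> bool" where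
  "lie_superalgebra scl V G br \<longleftrightarrow>
     superalgebra scl V G br \<and>
     (\<forall>p q. \<forall>x\<in>G p. \<forall>y\<in>G q. br x y = - scl (psign (p * q)) (br y x)) \<and>
     (\<forall>p q r. \<forall>x\<in>G p. \<forall>y\<in>G q. \<forall>z\<in>G r.
        br x (br y z) = br (br x y) z + scl (psign (p * q)) (br y (br x z)))"

definition poisson_superalgebra ::
    "('f::field_char_0 \<Rightarrow> 'v::ab_group_add \<Rightarrow> 'v) \<Rightarrow> 'v set \<Rightarrow> (bit \<Rightarrow> 'v set) \<Rightarrow>
     ('v \<Rightarrow> 'v \<Rightarrow> 'v) \<Rightarrow> ('v \<Rightarrow> 'v \<Rightarrow> 'v) \<Rightarrow> bool" where
  "poisson_superalgebra scl V G m br \<longleftrightarrow>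
     comm_assoc_superalgebra scl V G m \<and>
     lie_superalgebra scl V G br \<and>
     (\<forall>p q r. \<forall>x\<in>G p. \<forall>y\<in>G q. \<forall>z\<in>G r.
        br x (m y z) = m (br x y) z + scl (psign (p * q)) (m y (br x z)))"

section \<open>The universal Lie superalgebra\<close>

text \<open>
  The superspace \<open>A\<close> is a whole type \<open>'a\<close>, with parity decomposition \<open>A :: bit \<Rightarrow> 'a set\<close>.
  A map in \<open>n\<close> variables is a function on lists that vanishes on lists of length other
  than \<open>n\<close>; so all the spaces \<open>Hom(S\<^sup>n(A), A)\<close> lie in the one vector space
  \<open>'a list \<Rightarrow> 'a\<close>, and \<open>W(A)\<close> is their sum there. The index \<open>n\<close> is the number of
  variables, i.e. \<open>SHom scl A n\<close> is \<open>W\<^sub>k(A)\<close> with \<open>k = n - 1\<close>.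
\<close>

definition fscl :: "('f \<Rightarrow> 'a \<Rightarrow> 'a) \<Rightarrow> 'f \<Rightarrow> ('a list \<Rightarrow> 'a) \<Rightarrow> 'a list \<Rightarrow> 'a" where
  "fscl scl c X = (\<lambda>vs. scl c (X vs))"

definition SHom ::
    "('f::field \<Rightarrow> 'a::ab_group_add \<Rightarrow> 'a) \<Rightarrow> (bit \<Rightarrow> 'a set) \<Rightarrow> nat \<Rightarrow> ('a list \<Rightarrow> 'a) set" where
  "SHom scl A n = {X.
     (\<forall>vs. length vs \<noteq> n \<longrightarrow> X vs = 0) \<and>
     (\<forall>us vs. Vector_Spaces.linear scl scl (\<lambda>a. X (us @ a # vs))) \<and>
     (\<forall>p q. \<forall>a\<in>A p. \<forall>b\<in>A q. \<forall>us vs.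
        X (us @ a # b # vs) = scl (psign (p * q)) (X (us @ b # a # vs)))}"

definition W ::
    "('f::field \<Rightarrow> 'a::ab_group_add \<Rightarrow> 'a) \<Rightarrow> (bit \<Rightarrow> 'a set) \<Rightarrow> ('a list \<Rightarrow> 'a) set" where
  "W scl A = sum_of_subspaces (SHom scl A)"

definition W_par ::
    "('f::field \<Rightarrow> 'a::ab_group_add \<Rightarrow> 'a) \<Rightarrow> (bit \<Rightarrow> 'a set) \<Rightarrow> bit \<Rightarrow> ('a list \<Rightarrow> 'a) set" where
  "W_par scl A p = {X \<in> W scl A.
     \<forall>ps vs. list_all2 (\<lambda>v q. v \<in> A q) vs ps \<longrightarrow> X vs \<in> A (p + sum_list ps)}"

text \<open>
  Formulas with signs are given for homogeneous arguments only. If \<open>F ps vs\<close> is such a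
  formula for arguments \<open>vs\<close> of parities \<open>ps\<close>, then \<open>hom_ext A F\<close> is its multilinear
  extension: each argument is split into its even and its odd component.
\<close>

definition hom_ext ::
    "(bit \<Rightarrow> 'a::ab_group_add set) \<Rightarrow> (bit list \<Rightarrow> 'a list \<Rightarrow> 'a) \<Rightarrow> 'a list \<Rightarrow> 'a" where
  "hom_ext A F vs = (\<Sum>ps | length ps = length vs. F ps (map2 (part A) ps vs))"

text \<open>
  A permutation \<open>(i\<^sub>0, \<dots>, i\<^sub>k)\<close> of \<open>(0, \<dots>, k)\<close> is the function \<open>\<pi>\<close> with \<open>\<pi> s = i\<^sub>s\<close>.
  Positions and indices are counted from \<open>0\<close> throughout.
\<close>

definition shuffle_perms :: "nat \<Rightarrow> nat \<Rightarrow> (nat \<Rightarrow> nat) set" where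
  "shuffle_perms m n =
     {\<pi>. \<pi> permutes {..<n} \<and> strict_mono_on {..<m} \<pi> \<and> strict_mono_on {m..<n} \<pi>}"

definition perm_sign :: "bit list \<Rightarrow> (nat \<Rightarrow> nat) \<Rightarrow> 'f::field" where
  "perm_sign ps \<pi> = (-1) ^ card {(s, t). s < t \<and> t < length ps \<and> \<pi> t < \<pi> s \<and>
      ps ! \<pi> s = 1 \<and> ps ! \<pi> t = 1}"

text \<open>
  In \<open>box\<close> and in \<open>concat_prod\<close> below, the sum over \<open>m\<close> is the bilinear extension to
  elements with components of several degrees: if \<open>Y\<close> (resp. \<open>X\<close>) has exactly \<open>j\<close>
  variables, only \<open>m = j\<close> contributes.
\<close>

definition box ::
    "('f::field \<Rightarrow> 'a::ab_group_add \<Rightarrow> 'a) \<Rightarrow> (bit \<Rightarrow> 'a set) \<Rightarrow>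
     ('a list \<Rightarrow> 'a) \<Rightarrow> ('a list \<Rightarrow> 'a) \<Rightarrow> 'a list \<Rightarrow> 'a" where
  "box scl A X Y = hom_ext A (\<lambda>ps vs.
     let n = length vs in
       \<Sum>m\<le>n. \<Sum>\<pi>\<in>shuffle_perms m n. scl (perm_sign ps \<pi>)
         (X (Y (map (\<lambda>s. vs ! \<pi> s) [0..<m]) # map (\<lambda>s. vs ! \<pi> s) [m..<n])))"

definition W_bracket ::
    "('f::field \<Rightarrow> 'a::ab_group_add \<Rightarrow> 'a) \<Rightarrow> (bit \<Rightarrow> 'a set) \<Rightarrow>
     ('a list \<Rightarrow> 'a) \<Rightarrow> ('a list \<Rightarrow> 'a) \<Rightarrow> 'a list \<Rightarrow> 'a" where
  "W_bracket scl A X Y = (\<Sum>p\<in>{0, 1}. \<Sum>q\<in>{0, 1}.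
     let X' = part (W_par scl A) p X; Y' = part (W_par scl A) q Y in
       box scl A X' Y' - fscl scl (psign (p * q)) (box scl A Y' X'))"

section \<open>The prolongation of the derivations, and the concatenation product\<close>

definition const_elem :: "'a::zero \<Rightarrow> 'a list \<Rightarrow> 'a" where
  "const_elem a = (\<lambda>vs. if vs = [] then a else 0)"

definition Der ::
    "('f::field \<Rightarrow> 'a::ab_group_add \<Rightarrow> 'a) \<Rightarrow> (bit \<Rightarrow> 'a set) \<Rightarrow> ('a \<Rightarrow> 'a \<Rightarrow> 'a) \<Rightarrow> ('a \<Rightarrow> 'a) set" where
  "Der scl A mul = {D. Vector_Spaces.linear scl scl D \<and>
     (\<forall>p q. \<forall>a\<in>A p. \<forall>b\<in>A q.
        D (mul a b) = mul (D a) b + scl (psign (p * q)) (mul (D b) a))}"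

text \<open>\<open>P_comp scl A mul k\<close> is \<open>\<P>\<^sub>k(A)\<close>, i.e. degree \<open>k - 1\<close> of the full prolongation.\<close>

fun P_comp ::
    "('f::field \<Rightarrow> 'a::ab_group_add \<Rightarrow> 'a) \<Rightarrow> (bit \<Rightarrow> 'a set) \<Rightarrow> ('a \<Rightarrow> 'a \<Rightarrow> 'a) \<Rightarrow>
     nat \<Rightarrow> ('a list \<Rightarrow> 'a) set" where
  "P_comp scl A mul 0 = SHom scl A 0"
| "P_comp scl A mul (Suc 0) = {X \<in> SHom scl A 1. (\<lambda>a. X [a]) \<in> Der scl A mul}"
| "P_comp scl A mul (Suc (Suc k)) =
     {X \<in> SHom scl A (Suc (Suc k)).
        \<forall>a. W_bracket scl A X (const_elem a) \<in> P_comp scl A mul (Suc k)}"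

definition P_space ::
    "('f::field \<Rightarrow> 'a::ab_group_add \<Rightarrow> 'a) \<Rightarrow> (bit \<Rightarrow> 'a set) \<Rightarrow> ('a \<Rightarrow> 'a \<Rightarrow> 'a) \<Rightarrow>
     ('a list \<Rightarrow> 'a) set" where
  "P_space scl A mul = sum_of_subspaces (P_comp scl A mul)"

definition P_par ::
    "('f::field \<Rightarrow> 'a::ab_group_add \<Rightarrow> 'a) \<Rightarrow> (bit \<Rightarrow> 'a set) \<Rightarrow> ('a \<Rightarrow> 'a \<Rightarrow> 'a) \<Rightarrow>
     bit \<Rightarrow> ('a list \<Rightarrow> 'a) set" where
  "P_par scl A mul p = P_space scl A mul \<inter> W_par scl A p"

definition concat_prod ::
    "('f::field \<Rightarrow> 'a::ab_group_add \<Rightarrow> 'a) \<Rightarrow> (bit \<Rightarrow> 'a set) \<Rightarrow> ('a \<Rightarrow> 'a \<Rightarrow> 'a) \<Rightarrow>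
     ('a list \<Rightarrow> 'a) \<Rightarrow> ('a list \<Rightarrow> 'a) \<Rightarrow> 'a list \<Rightarrow> 'a" where
  "concat_prod scl A mul X Y = (\<Sum>q\<in>{0, 1}.
     let Y' = part (W_par scl A) q Y in
       hom_ext A (\<lambda>ps vs. let n = length vs in
         \<Sum>m\<le>n. \<Sum>\<pi>\<in>shuffle_perms m n.
           scl (perm_sign ps \<pi> * psign (q * (\<Sum>s<m. ps ! \<pi> s)))
             (mul (X (map (\<lambda>s. vs ! \<pi> s) [0..<m])) (Y' (map (\<lambda>s. vs ! \<pi> s) [m..<n])))))"

section \<open>The multilinear extension on homogeneous arguments\<close>

lemma finite_parity_lists: "finite {ps :: bit list. length ps = n}"
proof -
  have "finite (UNIV :: bit set)"
  proof (rule finite_subset)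
    show "UNIV \<subseteq> {0, 1 :: bit}"
    proof
      fix b :: bit show "b \<in> {0, 1}" by (cases b) simp_all
    qed
  qed simp
  then show ?thesis
    using finite_lists_length_eq[of "UNIV :: bit set" n] by simp
qed

lemma part_homogeneous:
  assumes "superspace scl V G" and "x \<in> G p"
  shows "part G p x = x" and "part G (p + 1) x = 0"
proof -
  interpret vector_space scl using assms(1) by (simp add: superspace_def)
  have ids: "internal_direct_sum scl V G" using assms(1) by (simp add: superspace_def)
  then have sub: "subspace (G q)" for q by (simp add: internal_direct_sum_def)
  have triv: "y = 0" if y: "y \<in> G q" "y \<in> G (q + 1)" for y q
  proof -
    have ne: "q \<noteq> q + 1" by (cases q) auto
    let ?x = "\<lambda>i. if i = q then y else - y"
    have sum0: "(\<Sum>i\<in>{q, q + 1}. ?x i) = 0" using ne by simp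
    have mem: "\<forall>i\<in>{q, q + 1}. ?x i \<in> G i" using y sub subspace_neg by auto
    have "\<forall>i\<in>{q, q + 1}. ?x i = 0"
    proof -
      have "\<And>I x. finite I \<Longrightarrow> \<forall>i\<in>I. x i \<in> G i \<Longrightarrow> (\<Sum>i\<in>I. x i) = 0 \<Longrightarrow> \<forall>i\<in>I. x i = 0"
        using ids unfolding internal_direct_sum_def by blast
      from this[of "{q, q + 1}" ?x] show ?thesis using sum0 mem by simp
    qed
    then show ?thesis by simp
  qed
  have pp: "p + 1 + 1 = p" by (cases p) auto
  show "part G p x = x" unfolding part_def
  proof (rule the_equality)
    show "x \<in> G p \<and> x - x \<in> G (p + 1)" using assms(2) sub subspace_0 by simp
    fix y assume y: "y \<in> G p \<and> x - y \<in> G (p + 1)"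
    then have "x - y \<in> G p" using assms(2) sub subspace_diff by blast
    with y triv show "y = x" by fastforce
  qed
  show "part G (p + 1) x = 0" unfolding part_def
  proof (rule the_equality)
    show "0 \<in> G (p + 1) \<and> x - 0 \<in> G (p + 1 + 1)" using assms(2) sub subspace_0 pp by simp
    fix y assume y: "y \<in> G (p + 1) \<and> x - y \<in> G (p + 1 + 1)"
    then have "x - (x - y) \<in> G p" using assms(2) sub subspace_diff pp by metis
    with y triv show "y = 0" by auto
  qed
qed

lemma hom_ext_homogeneous:
  assumes A: "superspace scl UNIV A"
    and hom: "list_all2 (\<lambda>v p. v \<in> A p) vs ps"
    and zero: "\<And>qs ws. length ws = length vs \<Longrightarrow> length qs = length vs \<Longrightarrow> 0 \<in> set ws \<Longrightarrow> F qs ws = 0"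
  shows "hom_ext A F vs = F ps vs"
proof -
  have len: "length ps = length vs" using hom by (simp add: list_all2_lengthD)
  have same: "map2 (part A) ps vs = vs"
    using hom len part_homogeneous(1)[OF A]
    by (intro nth_equalityI) (auto simp: list_all2_conv_all_nth)
  have other: "F qs (map2 (part A) qs vs) = 0" if qs: "length qs = length vs" "qs \<noteq> ps" for qs
  proof (rule zero)
    obtain i where i: "i < length vs" "qs ! i \<noteq> ps ! i"
      using qs len nth_equalityI by metis
    then have "qs ! i = ps ! i + 1" by (cases "qs ! i"; cases "ps ! i") auto
    then have "map2 (part A) qs vs ! i = 0"
      using i qs hom part_homogeneous(2)[OF A] by (auto simp: list_all2_conv_all_nth)
    then show "0 \<in> set (map2 (part A) qs vs)"
      using i qs by (metis length_map length_zip min.idem nth_mem)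
  qed (use qs in auto)
  have "hom_ext A F vs = (\<Sum>qs\<in>{ps}. F qs (map2 (part A) qs vs))"
    unfolding hom_ext_def
    by (rule sum.mono_neutral_right) (use finite_parity_lists len other in auto)
  then show ?thesis using same by simp
qed

end

(*
  For a homogeneous element a of parity s write i_a X for the cochain X(a, ...). In a shuffle
  the first argument either opens the first block or opens the second one, so that for Y of
  parity q both the concatenation product and the box product satisfy
    i_a (X * Y) = X * i_a Y + (-1)^(s q) (i_a X) * Y.
  The bracket inherits this rule. Every identity of a Poisson superalgebra, and closure under the
  derivation condition, is compatible with the rule; by induction on the list of arguments it
  therefore only has to be checked for the empty list (for a single argument in the case of the
  derivation condition), where it is an identity in A. The derivation condition defining the
  prolongation amounts to being a derivation in the last argument.
*)
theory Submission
  imports Defs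
begin

section \<open>Shuffle sums\<close>

text \<open>The operations are given by sums over shuffles, the identities are proved on a
  recursion, and the obstacle is the passage between the two. Concatenation carries a sign with the
  parity of Y and obeys the rule at once. The box product carries no such sign: an \<open>a\<close>
  that enters the second block stands behind Y(...), and bringing it to the front by supersymmetry
  of X costs exactly the sign in the rule (\<open>shuffle_sum_box_move\<close>). Contraction changes
  parities. So the products take the parities as explicit bits, and each identity is proved for all
  parities at once; only then do the induction hypotheses apply to contractions. Shortening the
  argument list rather than lowering a degree lets cochains with components of several degrees be
  treated without splitting them. The parity components of an element of the prolongation must stay
  inside it. They come from conjugation with the grading involution of A, an algebra automorphism,
  which therefore respects the derivation condition; the factor 1/2 of the projections exists in
  characteristic 0.\<close>

lemma psign_0 [simp]: "psign 0 = 1"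
  and psign_1 [simp]: "psign 1 = -1"
  by (simp_all add: psign_def)

lemma bit_add_self [simp]: "p + p = (0::bit)"
  by (cases p; simp)

lemma psign_mult_self [simp]: "psign p * psign p = (1 :: 'f::field)"
  by (cases p; simp)

lemma psign_add: "psign (p + q) = (psign p * psign q :: 'f::field)"
  by (cases p; cases q; simp)

text \<open>Inserts the new index \<open>0\<close> at position \<open>k\<close>; the old indices are shifted up by one.\<close>

definition shuffle_ins :: "nat \<Rightarrow> (nat \<Rightarrow> nat) \<Rightarrow> nat \<Rightarrow> nat" where
  "shuffle_ins k \<pi> s = (if s < k then Suc (\<pi> s) else if s = k then 0 else Suc (\<pi> (s - 1)))"

lemma shuffle_ins_0_Suc [simp]: "shuffle_ins 0 \<pi> (Suc s) = Suc (\<pi> s)"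
  and shuffle_ins_0_0 [simp]: "shuffle_ins 0 \<pi> 0 = 0"
  by (simp_all add: shuffle_ins_def)

lemma shuffle_ins_less [simp]: "s < k \<Longrightarrow> shuffle_ins k \<pi> s = Suc (\<pi> s)"
  and shuffle_ins_eq [simp]: "shuffle_ins k \<pi> k = 0"
  and shuffle_ins_Suc [simp]: "k \<le> s \<Longrightarrow> shuffle_ins k \<pi> (Suc s) = Suc (\<pi> s)"
  by (simp_all add: shuffle_ins_def)

text \<open>Allows sums over shuffles to be reindexed along the insertion. The old entry
  \<open>s\<close> is read off at \<open>s\<close> or \<open>Suc s\<close>, depending on its side of
  \<open>k\<close>.\<close>

lemma inj_shuffle_ins: "inj (shuffle_ins k)"
proof (rule injI, rule ext)
  fix \<pi> \<rho> s assume eq: "shuffle_ins k \<pi> = shuffle_ins k \<rho>"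
  have "shuffle_ins k \<pi> (if s < k then s else Suc s) = shuffle_ins k \<rho> (if s < k then s else Suc s)"
    by (simp add: eq)
  then show "\<pi> s = \<rho> s" by (auto split: if_splits)
qed

lemma shuffle_ins_permutes:
  assumes "\<pi> permutes {..<n}" "k \<le> n"
  shows "shuffle_ins k \<pi> permutes {..<Suc n}"
proof (rule inj_imp_permutes)
  show "inj_on (shuffle_ins k \<pi>) {..<Suc n}"
    by (auto simp: inj_on_def shuffle_ins_def inj_eq[OF permutes_inj[OF assms(1)]] split: if_splits)
  show "shuffle_ins k \<pi> s \<in> {..<Suc n}" if "s \<in> {..<Suc n}" for s
    using that assms permutes_in_image[OF assms(1), of s] permutes_in_image[OF assms(1), of "s - 1"]
    by (auto simp: shuffle_ins_def)
  show "shuffle_ins k \<pi> s = s" if "s \<notin> {..<Suc n}" for s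
    using that assms permutes_not_in[OF assms(1), of "s - 1"] by (auto simp: shuffle_ins_def)
qed simp

text \<open>Deleting position \<open>k\<close> and lowering the other values by one undoes the
  insertion. Subtraction of naturals loses nothing here, since injectivity makes \<open>k\<close>
  the only position with value 0.\<close>

lemma shuffle_ins_remove:
  assumes \<pi>: "\<pi> permutes {..<Suc n}" and k: "\<pi> k = 0" "k \<le> n"
  obtains \<rho> where "\<rho> permutes {..<n}" "\<pi> = shuffle_ins k \<rho>"
proof
  define \<rho> where "\<rho> s = \<pi> (if s < k then s else Suc s) - 1" for s
  have pos: "\<pi> s > 0" if "s \<noteq> k" for s
    using that k injD[OF permutes_inj[OF \<pi>], of s k] by auto
  show eq: "\<pi> = shuffle_ins k \<rho>"
  proof
    fix s show "\<pi> s = shuffle_ins k \<rho> s"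
      using pos[of s] k by (auto simp: shuffle_ins_def \<rho>_def)
  qed
  show "\<rho> permutes {..<n}"
  proof (rule inj_imp_permutes)
    show "inj_on \<rho> {..<n}"
    proof (rule inj_onI)
      fix s t assume "\<rho> s = \<rho> t"
      then have "shuffle_ins k \<rho> (if s < k then s else Suc s) =
          shuffle_ins k \<rho> (if t < k then t else Suc t)"
        by auto
      then have "(if s < k then s else Suc s) = (if t < k then t else Suc t)"
        using eq injD[OF permutes_inj[OF \<pi>]] by metis
      then show "s = t" by (auto split: if_splits)
    qed
    show "\<rho> s \<in> {..<n}" if "s \<in> {..<n}" for s
      using that pos[of "if s < k then s else Suc s"]
        permutes_in_image[OF \<pi>, of "if s < k then s else Suc s"] by (auto simp: \<rho>_def)
    show "\<rho> s = s" if "s \<notin> {..<n}" for s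
      using that k permutes_not_in[OF \<pi>, of "Suc s"] by (auto simp: \<rho>_def)
  qed simp
qed

section \<open>Decomposition of shuffles by the block of the index 0\<close>

lemma strict_mono_on_Suc_image:
  "strict_mono_on (Suc ` S) f \<longleftrightarrow> strict_mono_on S (\<lambda>s. f (Suc s))"
  by (simp add: strict_mono_on_def) blast

text \<open>Meant for the position of the index 0: it opens its block and has the least value there,
  so it adds no monotonicity condition.\<close>

lemma strict_mono_on_insert_least:
  fixes f :: "'b::linorder \<Rightarrow> 'c::order"
  assumes "\<And>s. s \<in> S \<Longrightarrow> k < s" "\<And>s. s \<in> S \<Longrightarrow> f k < f s"
  shows "strict_mono_on (insert k S) f \<longleftrightarrow> strict_mono_on S f" (is "?L \<longleftrightarrow> ?R")
proof
  show "?L \<Longrightarrow> ?R" by (rule monotone_on_subset) auto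
  assume R: ?R
  show ?L
  proof (rule strict_mono_onI)
    fix r s assume "r \<in> insert k S" "s \<in> insert k S" "r < s"
    then have "r = k \<and> s \<in> S \<or> r \<in> S \<and> s \<in> S" using assms(1) order.asym by blast
    then show "f r < f s" using assms(2) strict_mono_onD[OF R] \<open>r < s\<close> by blast
  qed
qed

text \<open>The index 0 opens the first block, which becomes longer by one.\<close>

lemma shuffle_ins_0_mem:
  assumes "\<pi> permutes {..<n}" "m \<le> n"
  shows "shuffle_ins 0 \<pi> \<in> shuffle_perms (Suc m) (Suc n) \<longleftrightarrow> \<pi> \<in> shuffle_perms m n"
proof -
  have "strict_mono_on {..<Suc m} (shuffle_ins 0 \<pi>) \<longleftrightarrow> strict_mono_on {..<m} \<pi>"
  proof -
    have "strict_mono_on {..<Suc m} (shuffle_ins 0 \<pi>) \<longleftrightarrow> strict_mono_on (Suc ` {..<m}) (shuffle_ins 0 \<pi>)"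
      unfolding lessThan_Suc_eq_insert_0 by (rule strict_mono_on_insert_least) auto
    also have "\<dots> \<longleftrightarrow> strict_mono_on {..<m} \<pi>"
      by (simp only: strict_mono_on_Suc_image) (simp add: strict_mono_on_def)
    finally show ?thesis .
  qed
  moreover have "strict_mono_on {Suc m..<Suc n} (shuffle_ins 0 \<pi>) \<longleftrightarrow> strict_mono_on {m..<n} \<pi>"
    unfolding image_Suc_atLeastLessThan[symmetric] strict_mono_on_Suc_image
    by (simp add: strict_mono_on_def)
  ultimately show ?thesis
    using assms shuffle_ins_permutes[OF assms(1), of 0] by (simp add: shuffle_perms_def)
qed

text \<open>The index 0 opens the second block; the first block keeps its length
  \<open>m\<close>.\<close>

lemma shuffle_ins_mem:
  assumes "\<pi> permutes {..<n}" "m \<le> n"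
  shows "shuffle_ins m \<pi> \<in> shuffle_perms m (Suc n) \<longleftrightarrow> \<pi> \<in> shuffle_perms m n"
proof -
  have "strict_mono_on {..<m} (shuffle_ins m \<pi>) \<longleftrightarrow> strict_mono_on {..<m} \<pi>"
    by (simp add: strict_mono_on_def)
  moreover have "strict_mono_on {m..<Suc n} (shuffle_ins m \<pi>) \<longleftrightarrow> strict_mono_on {m..<n} \<pi>"
  proof -
    have ins: "{m..<Suc n} = insert m {Suc m..<Suc n}" using assms(2) by auto
    have "strict_mono_on {m..<Suc n} (shuffle_ins m \<pi>) \<longleftrightarrow>
        strict_mono_on {Suc m..<Suc n} (shuffle_ins m \<pi>)"
      unfolding ins by (rule strict_mono_on_insert_least) (auto simp: shuffle_ins_def)
    also have "\<dots> \<longleftrightarrow> strict_mono_on {m..<n} \<pi>"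
      unfolding image_Suc_atLeastLessThan[symmetric] strict_mono_on_Suc_image
      by (simp add: strict_mono_on_def)
    finally show ?thesis .
  qed
  ultimately show ?thesis
    using assms shuffle_ins_permutes[OF assms] by (simp add: shuffle_perms_def)
qed

text \<open>In an increasing block the least value 0 can only be the first entry, and the blocks
  start at 0 and at \<open>m\<close>.\<close>

lemma shuffle_perms_zero_pos:
  assumes "\<pi> \<in> shuffle_perms m (Suc n)" "\<pi> k = 0" "k \<le> n"
  shows "k = 0 \<or> k = m"
proof (rule ccontr)
  assume "\<not> ?thesis"
  then consider "0 < k" "k < m" | "m < k" by linarith
  then show False
  proof cases
    case 1
    then have "\<pi> 0 < \<pi> k"
      using assms(1) by (intro strict_mono_onD[of "{..<m}" \<pi>]) (auto simp: shuffle_perms_def)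
    then show False using assms by simp
  next
    case 2
    then have "\<pi> m < \<pi> k"
      using assms by (intro strict_mono_onD[of "{m..<Suc n}" \<pi>]) (auto simp: shuffle_perms_def)
    then show False using assms by simp
  qed
qed

lemma finite_shuffle_perms [simp]: "finite (shuffle_perms m n)"
  unfolding shuffle_perms_def by (rule finite_subset[OF _ finite_permutations[of "{..<n}"]]) auto

lemma shuffle_perms_permutes: "\<pi> \<in> shuffle_perms m n \<Longrightarrow> \<pi> permutes {..<n}"
  by (simp add: shuffle_perms_def)

text \<open>An empty block has no first entry, whence the two exceptional cases. For
  \<open>m = 0\<close> both starting positions coincide, and the shuffle is counted with the second
  block.\<close>

lemma shuffle_perms_Suc:
  assumes "m \<le> Suc n"
  shows "shuffle_perms m (Suc n) =
    (if m = 0 then {} else shuffle_ins 0 ` shuffle_perms (m - 1) n) \<union>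
    (if m = Suc n then {} else shuffle_ins m ` shuffle_perms m n)" (is "?L = ?R")
proof
  show "?R \<subseteq> ?L"
  proof
    fix \<pi> assume "\<pi> \<in> ?R"
    then consider \<rho> where "m \<noteq> 0" "\<rho> \<in> shuffle_perms (m - 1) n" "\<pi> = shuffle_ins 0 \<rho>"
      | \<rho> where "m \<noteq> Suc n" "\<rho> \<in> shuffle_perms m n" "\<pi> = shuffle_ins m \<rho>"
      by (auto split: if_splits)
    then show "\<pi> \<in> ?L"
    proof cases
      case 1
      then show ?thesis
        using assms shuffle_ins_0_mem[OF shuffle_perms_permutes[OF 1(2)], of "m - 1"] by simp
    next
      case 2
      then show ?thesis
        using assms shuffle_ins_mem[OF shuffle_perms_permutes[OF 2(2)]] by simp
    qed
  qed
  show "?L \<subseteq> ?R"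
  proof
    fix \<pi> assume \<pi>: "\<pi> \<in> ?L"
    then have perm: "\<pi> permutes {..<Suc n}" by (rule shuffle_perms_permutes)
    then have "0 \<in> \<pi> ` {..<Suc n}" by (simp add: permutes_image)
    then obtain k where k: "\<pi> k = 0" "k \<le> n" by (auto simp: less_Suc_eq_le image_iff)
    obtain \<rho> where \<rho>: "\<rho> permutes {..<n}" "\<pi> = shuffle_ins k \<rho>"
      using shuffle_ins_remove[OF perm k] .
    from shuffle_perms_zero_pos[OF \<pi> k] consider "k = m" | "k = 0" "m \<noteq> 0" by auto
    then show "\<pi> \<in> ?R"
    proof cases
      case 1
      then have "\<rho> \<in> shuffle_perms m n" using \<rho> \<pi> k shuffle_ins_mem by simp
      then show ?thesis using 1 \<rho> k by auto
    next
      case 2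
      then have "\<rho> \<in> shuffle_perms (m - 1) n"
        using \<rho> \<pi> assms shuffle_ins_0_mem[OF \<rho>(1), of "m - 1"] by simp
      then show ?thesis using 2 \<rho> by auto
    qed
  qed
qed

text \<open>Pascal's rule for shuffles, summed over the block size. The two families are disjoint,
  because an insertion at \<open>m \<noteq> 0\<close> leaves a nonzero value at position 0; shifting
  \<open>m\<close> in the first family gives both sums the same range.\<close>

lemma sum_shuffle_perms_Suc:
  fixes G :: "nat \<Rightarrow> (nat \<Rightarrow> nat) \<Rightarrow> 'b::comm_monoid_add"
  shows "(\<Sum>m\<le>Suc n. \<Sum>\<pi>\<in>shuffle_perms m (Suc n). G m \<pi>) =
    (\<Sum>m\<le>n. \<Sum>\<pi>\<in>shuffle_perms m n. G (Suc m) (shuffle_ins 0 \<pi>)) +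
    (\<Sum>m\<le>n. \<Sum>\<pi>\<in>shuffle_perms m n. G m (shuffle_ins m \<pi>))"
proof -
  let ?U = "\<lambda>m. if m = 0 then 0 else \<Sum>\<pi>\<in>shuffle_perms (m - 1) n. G m (shuffle_ins 0 \<pi>)"
  let ?V = "\<lambda>m. if m = Suc n then 0 else \<Sum>\<pi>\<in>shuffle_perms m n. G m (shuffle_ins m \<pi>)"
  have "(\<Sum>\<pi>\<in>shuffle_perms m (Suc n). G m \<pi>) = ?U m + ?V m" if m: "m \<le> Suc n" for m
  proof -
    let ?A = "if m = 0 then {} else shuffle_ins 0 ` shuffle_perms (m - 1) n"
    let ?B = "if m = Suc n then {} else shuffle_ins m ` shuffle_perms m n"
    have "?A \<inter> ?B = {}"
    proof -
      have "shuffle_ins 0 \<pi> \<noteq> shuffle_ins m \<rho>" if "m \<noteq> 0" for \<pi> \<rho>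
        using that shuffle_ins_less[of 0 m \<rho>] shuffle_ins_0_0[of \<pi>]
        by (metis nat.distinct(1) not_gr_zero)
      then show ?thesis by auto
    qed
    then have "(\<Sum>\<pi>\<in>shuffle_perms m (Suc n). G m \<pi>) = sum (G m) ?A + sum (G m) ?B"
      unfolding shuffle_perms_Suc[OF m] by (intro sum.union_disjoint) auto
    also have "sum (G m) ?A = ?U m"
      by (simp add: sum.reindex[OF inj_on_subset[OF inj_shuffle_ins]])
    also have "sum (G m) ?B = ?V m"
      by (simp add: sum.reindex[OF inj_on_subset[OF inj_shuffle_ins]])
    finally show ?thesis .
  qed
  then have "(\<Sum>m\<le>Suc n. \<Sum>\<pi>\<in>shuffle_perms m (Suc n). G m \<pi>) = (\<Sum>m\<le>Suc n. ?U m) + (\<Sum>m\<le>Suc n. ?V m)"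
    by (simp add: sum.distrib)
  also have "(\<Sum>m\<le>Suc n. ?U m) = (\<Sum>m\<le>n. ?U (Suc m))"
    by (subst sum.atMost_Suc_shift) simp
  also have "(\<Sum>m\<le>Suc n. ?V m) = (\<Sum>m\<le>n. ?V m)" by simp
  finally show ?thesis by simp
qed

text \<open>Brings this sign into the shape of \<open>perm_sign\<close>, a power of -1 with a
  cardinality as exponent, so that signs can be compared by counting pairs.\<close>

lemma psign_mult_sum:
  fixes k :: nat
  shows "psign (p * (\<Sum>s<k. x s)) = ((-1) ^ card {s. s < k \<and> p = 1 \<and> x s = 1} :: 'f::field)"
proof (induction k)
  case (Suc k)
  have "{s. s < Suc k \<and> p = 1 \<and> x s = 1} =
      {s. s < k \<and> p = 1 \<and> x s = 1} \<union> (if p = 1 \<and> x k = 1 then {k} else {})"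
    by (auto simp: less_Suc_eq)
  moreover have "card \<dots> = card {s. s < k \<and> p = 1 \<and> x s = 1} + card (if p = 1 \<and> x k = 1 then {k} else {})"
    by (intro card_Un_disjoint) auto
  ultimately have "card {s. s < Suc k \<and> p = 1 \<and> x s = 1} =
      card {s. s < k \<and> p = 1 \<and> x s = 1} + (if p = 1 \<and> x k = 1 then 1 else 0)" by simp
  moreover have "psign (p * (\<Sum>s<Suc k. x s)) = (psign (p * (\<Sum>s<k. x s)) * psign (p * x k) :: 'f)"
    by (simp only: sum.lessThan_Suc distrib_left psign_add)
  ultimately show ?case
    unfolding Suc.IH by (cases p; cases "x k") (simp_all del: bit_not_zero_iff bit_not_one_iff)
qed simp

text \<open>The value 0 at position \<open>k\<close> is smaller than everything before it and forms
  no inversion with anything after it. So the new odd inversions are the pairs \<open>(s, k)\<close>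
  with \<open>s < k\<close> and both entries odd.\<close>

lemma perm_sign_shuffle_ins:
  assumes \<pi>: "\<pi> permutes {..<length ps}" and k: "k \<le> length ps"
  shows "perm_sign (p # ps) (shuffle_ins k \<pi>) =
    (perm_sign ps \<pi> * psign (p * (\<Sum>s<k. ps ! \<pi> s)) :: 'f::field)"
proof -
  \<comment> \<open>The order embedding of the old positions into the new ones, which leaves out
    \<open>k\<close>.\<close>
  let ?e = "\<lambda>s. if s < k then s else Suc s"
  let ?inv = "{(s, t). s < t \<and> t < length ps \<and> \<pi> t < \<pi> s \<and> ps ! \<pi> s = 1 \<and> ps ! \<pi> t = 1}"
  let ?L = "{s. s < k \<and> p = 1 \<and> ps ! \<pi> s = 1}"
  have e: "shuffle_ins k \<pi> (?e s) = Suc (\<pi> s)" for s by simp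
  have inj: "inj_on (map_prod ?e ?e) UNIV"
    by (auto simp: inj_on_def split: if_splits)
  have "{(s, t). s < t \<and> t < length (p # ps) \<and> shuffle_ins k \<pi> t < shuffle_ins k \<pi> s \<and>
      (p # ps) ! shuffle_ins k \<pi> s = 1 \<and> (p # ps) ! shuffle_ins k \<pi> t = 1} =
      map_prod ?e ?e ` ?inv \<union> (\<lambda>s. (s, k)) ` ?L" (is "?I = ?R")
  proof
    show "?R \<subseteq> ?I" using k by auto
    show "?I \<subseteq> ?R"
    proof clarify
      fix s t assume st: "s < t" "t < length (p # ps)" "shuffle_ins k \<pi> t < shuffle_ins k \<pi> s"
        "(p # ps) ! shuffle_ins k \<pi> s = 1" "(p # ps) ! shuffle_ins k \<pi> t = 1"
        "(s, t) \<notin> (\<lambda>s. (s, k)) ` ?L"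
      have "s \<noteq> k" using st(3) by auto
      then obtain s' where s': "s = ?e s'"
        by (cases "s < k") (auto intro: that[of "s - 1"] that[of s])
      have "t \<noteq> k" using st s' by (auto simp: image_iff split: if_splits)
      then obtain t' where t': "t = ?e t'"
        by (cases "t < k") (auto intro: that[of "t - 1"] that[of t])
      have "(s', t') \<in> ?inv"
        using st(1-5) k unfolding s' t' e by (auto split: if_splits)
      then show "(s, t) \<in> map_prod ?e ?e ` ?inv" unfolding s' t' by (rule rev_image_eqI) simp
    qed
  qed
  moreover have "?inv \<subseteq> {..<length ps} \<times> {..<length ps}" by auto
  then have "finite ?inv" by (rule finite_subset) simp
  moreover have "map_prod ?e ?e ` ?inv \<inter> (\<lambda>s. (s, k)) ` ?L = {}"
    by (auto split: if_splits)
  ultimately have "card ?I = card (map_prod ?e ?e ` ?inv) + card ((\<lambda>s. (s, k)) ` ?L)"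
    by (simp add: card_Un_disjoint)
  also have "card (map_prod ?e ?e ` ?inv) = card ?inv"
    by (rule card_image[OF inj_on_subset[OF inj subset_UNIV]])
  also have "card ((\<lambda>s. (s, k)) ` ?L) = card ?L"
    by (rule card_image) (simp add: inj_on_def)
  finally show ?thesis
    unfolding perm_sign_def psign_mult_sum by (simp add: power_add)
qed

text \<open>Common form of both products: concatenation is the case where \<open>B us ws\<close>
  multiplies X(us) by Y(ws) and \<open>q\<close> is the parity of Y, the box product is the case
  \<open>B us ws = X (Y us # ws)\<close> with \<open>q = 0\<close>.\<close>

definition shuffle_sum ::
    "('f::field \<Rightarrow> 'a::ab_group_add \<Rightarrow> 'a) \<Rightarrow> bit \<Rightarrow> ('b list \<Rightarrow> 'b list \<Rightarrow> 'a) \<Rightarrow>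
     bit list \<Rightarrow> 'b list \<Rightarrow> 'a" where
  "shuffle_sum scl q B ps vs = (\<Sum>m\<le>length vs. \<Sum>\<pi>\<in>shuffle_perms m (length vs).
     scl (perm_sign ps \<pi> * psign (q * (\<Sum>s<m. ps ! \<pi> s)))
       (B (map (\<lambda>s. vs ! \<pi> s) [0..<m]) (map (\<lambda>s. vs ! \<pi> s) [m..<length vs])))"

section \<open>Recursion of shuffle sums over the first argument\<close>

lemma shuffle_perms_0_0 [simp]: "shuffle_perms 0 0 = {id}"
  by (auto simp: shuffle_perms_def permutes_empty strict_mono_on_def)

context vector_space
begin

lemma shuffle_sum_Nil [simp]: "shuffle_sum scale q B [] [] = B [] []"
  by (simp add: shuffle_sum_def perm_sign_def)

text \<open>In the first block \<open>a\<close> creates no inversion but adds \<open>p\<close> to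
  the parities that are paired with \<open>q\<close>. In the second block it is inverted with the
  odd entries of the first block if \<open>p\<close> is odd, and this sign merges with the twist:
  \<open>q\<close> becomes \<open>q + p\<close>.\<close>

lemma shuffle_sum_Cons:
  assumes len: "length ps = length vs"
  shows "shuffle_sum scale q B (p # ps) (a # vs) =
    scale (psign (p * q)) (shuffle_sum scale q (\<lambda>us. B (a # us)) ps vs) +
    shuffle_sum scale (q + p) (\<lambda>us ws. B us (a # ws)) ps vs"
proof -
  let ?n = "length vs"
  have upt1: "[0..<Suc m] = 0 # map Suc [0..<m]"
    and upt2: "[Suc m..<Suc ?n] = map Suc [m..<?n]"
    and upt3: "m \<le> ?n \<Longrightarrow> [m..<Suc ?n] = m # map Suc [m..<?n]" for m
    by (simp_all only: map_Suc_upt) (simp_all add: upt_conv_Cons del: upt_Suc)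
  have map1: "map (\<lambda>s. (a # vs) ! shuffle_ins 0 \<pi> s) [0..<Suc m] = a # map (\<lambda>s. vs ! \<pi> s) [0..<m]"
    and map2: "map (\<lambda>s. (a # vs) ! shuffle_ins 0 \<pi> s) [Suc m..<Suc ?n] = map (\<lambda>s. vs ! \<pi> s) [m..<?n]"
    and map3: "map (\<lambda>s. (a # vs) ! shuffle_ins m \<pi> s) [0..<m] = map (\<lambda>s. vs ! \<pi> s) [0..<m]"
    and map4: "m \<le> ?n \<Longrightarrow> map (\<lambda>s. (a # vs) ! shuffle_ins m \<pi> s) [m..<Suc ?n] =
        a # map (\<lambda>s. vs ! \<pi> s) [m..<?n]"
    for \<pi> m
    by (simp_all add: upt1 upt2 upt3 del: upt_Suc)
  have sum1: "(\<Sum>s<Suc m. (p # ps) ! shuffle_ins 0 \<pi> s) = p + (\<Sum>s<m. ps ! \<pi> s)"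
    and sum2: "(\<Sum>s<m. (p # ps) ! shuffle_ins m \<pi> s) = (\<Sum>s<m. ps ! \<pi> s)" for \<pi> m
    by (simp_all add: sum.lessThan_Suc_shift del: sum.lessThan_Suc)
  have sign1: "perm_sign (p # ps) (shuffle_ins 0 \<pi>) = perm_sign ps \<pi>" if "\<pi> permutes {..<?n}" for \<pi>
    using perm_sign_shuffle_ins[of \<pi> ps 0 p] that len by simp
  have sign2: "psign ((q + p) * c) = (psign (p * c) * psign (q * c) :: 'a)" for c
    unfolding distrib_right psign_add by (rule mult.commute)
  have sign3: "psign (q * (p + c)) = (psign (p * q) * psign (q * c) :: 'a)" for c
    unfolding distrib_left psign_add by (simp only: mult.commute)
  show ?thesis
    unfolding shuffle_sum_def scale_sum_right list.size(4) add_Suc_right add_0_right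
        sum_shuffle_perms_Suc
  proof (intro arg_cong2[where f = "(+)"] sum.cong refl)
    fix m \<pi> assume m: "m \<in> {..?n}" and "\<pi> \<in> shuffle_perms m ?n"
    then have \<pi>: "\<pi> permutes {..<?n}" by (simp add: shuffle_perms_permutes)
    show "scale (perm_sign (p # ps) (shuffle_ins 0 \<pi>) *
          psign (q * (\<Sum>s<Suc m. (p # ps) ! shuffle_ins 0 \<pi> s)))
         (B (map (\<lambda>s. (a # vs) ! shuffle_ins 0 \<pi> s) [0..<Suc m])
            (map (\<lambda>s. (a # vs) ! shuffle_ins 0 \<pi> s) [Suc m..<Suc ?n])) =
        scale (psign (p * q)) (scale (perm_sign ps \<pi> * psign (q * (\<Sum>s<m. ps ! \<pi> s)))
         (B (a # map (\<lambda>s. vs ! \<pi> s) [0..<m]) (map (\<lambda>s. vs ! \<pi> s) [m..<?n])))"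
      unfolding map1 map2 sum1 sign1[OF \<pi>] sign3 scale_scale by (simp only: mult_ac)
    show "scale (perm_sign (p # ps) (shuffle_ins m \<pi>) * psign (q * (\<Sum>s<m. (p # ps) ! shuffle_ins m \<pi> s)))
         (B (map (\<lambda>s. (a # vs) ! shuffle_ins m \<pi> s) [0..<m])
            (map (\<lambda>s. (a # vs) ! shuffle_ins m \<pi> s) [m..<Suc ?n])) =
        scale (perm_sign ps \<pi> * psign ((q + p) * (\<Sum>s<m. ps ! \<pi> s)))
         (B (map (\<lambda>s. vs ! \<pi> s) [0..<m]) (a # map (\<lambda>s. vs ! \<pi> s) [m..<?n]))"
      using m \<pi> len
      by (simp only: map3 sum2 map4 sign2 atMost_iff perm_sign_shuffle_ins mult_ac)
  qed
qed

end

section \<open>Superspaces and the cochain spaces\<close>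

text \<open>These rules turn the arguments of \<^const>\<open>psign\<close> into \<^const>\<open>of_bool\<close> terms, on which
  \<open>psign_add\<close> does not fire.\<close>

declare add_bit_eq_xor [simp del] mult_bit_eq_and [simp del]

lemma UNIV_bit: "UNIV = {0, 1 :: bit}"
proof -
  have "b \<in> {0, 1}" for b :: bit by (cases b) simp_all
  then show ?thesis by blast
qed

instance bit :: finite
  by standard (simp add: UNIV_bit)

lemma sum_bit: "(\<Sum>p\<in>(UNIV :: bit set). f p) = f 0 + f 1"
  by (simp add: UNIV_bit)

lemma sum_of_subspaces_bit:
  assumes "\<And>p. 0 \<in> G p"
  shows "sum_of_subspaces G = {x + y | x y. x \<in> G (0 :: bit) \<and> y \<in> G 1}"
proof (intro set_eqI iffI)
  fix z assume "z \<in> sum_of_subspaces G"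
  then obtain I x where z: "z = (\<Sum>i\<in>I. x i)" and x: "\<forall>i\<in>I. x i \<in> G i"
    by (auto simp: sum_of_subspaces_def)
  let ?x = "\<lambda>i. if i \<in> I then x i else 0"
  have "z = (\<Sum>i\<in>UNIV. ?x i)"
    unfolding z by (rule sum.mono_neutral_cong_left) auto
  then have "z = ?x 0 + ?x 1" by (simp only: sum_bit)
  moreover have "?x i \<in> G i" for i using x assms by simp
  ultimately show "z \<in> {x + y | x y. x \<in> G 0 \<and> y \<in> G 1}" by blast
next
  fix z assume "z \<in> {x + y | x y. x \<in> G 0 \<and> y \<in> G 1}"
  then obtain x y where "z = x + y" "x \<in> G 0" "y \<in> G 1" by blast
  moreover have "(\<Sum>i\<in>{0, 1 :: bit}. if i = 0 then x else y) = x + y" by simp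
  ultimately have "z = (\<Sum>i\<in>{0, 1 :: bit}. if i = 0 then x else y)"
      "\<forall>i\<in>{0, 1 :: bit}. (if i = 0 then x else y) \<in> G i"
    by simp_all
  then show "z \<in> sum_of_subspaces G"
    unfolding sum_of_subspaces_def by blast
qed

text \<open>With only two summands, independence of finite families reduces to a trivial
  intersection.\<close>

lemma superspaceI:
  assumes "vector_space scl" and sub: "\<And>p. module.subspace scl (G p)"
    and V: "\<And>x. x \<in> V \<longleftrightarrow> (\<exists>y\<in>G 0. \<exists>z\<in>G 1. x = y + z)"
    and disj: "\<And>x. x \<in> G 0 \<Longrightarrow> x \<in> G 1 \<Longrightarrow> x = 0"
  shows "superspace scl V G"
proof -
  interpret vector_space scl by fact
  have 0: "0 \<in> G p" for p using subspace_0[OF sub] .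
  have "x i = 0" if x: "\<forall>i\<in>I. x i \<in> G i" and sum: "(\<Sum>i\<in>I. x i) = 0" and i: "i \<in> I" for I x i
  proof -
    let ?x = "\<lambda>i. if i \<in> I then x i else 0"
    have mem: "?x i \<in> G i" for i using x 0 by simp
    have "(\<Sum>i\<in>I. x i) = (\<Sum>i\<in>UNIV. ?x i)"
      by (rule sum.mono_neutral_cong_left) auto
    then have eq: "?x 0 + ?x 1 = 0" using sum by (simp only: sum_bit)
    then have "?x 0 = - ?x 1" by (rule eq_neg_iff_add_eq_0[THEN iffD2])
    with mem[of 0] subspace_neg[OF sub mem[of 1]] have "?x 0 \<in> G 0" "?x 0 \<in> G 1"
      by (simp_all only:)
    then have x0: "?x 0 = 0" by (rule disj)
    then have x1: "?x 1 = 0" using eq by (simp only: add_0_left)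
    show ?thesis using i x0 x1 by (cases i) auto
  qed
  moreover have "V = sum_of_subspaces G"
    unfolding sum_of_subspaces_bit[of G, OF 0] using V by blast
  ultimately show ?thesis
    using assms(1) sub by (simp add: superspace_def internal_direct_sum_def)
qed

section \<open>Parity components in a superspace\<close>

locale super_space = vector_space scl
  for scl :: "'f::field \<Rightarrow> 'v::ab_group_add \<Rightarrow> 'v" +
  fixes V :: "'v set" and G :: "bit \<Rightarrow> 'v set"
  assumes superspace: "superspace scl V G"
begin

lemma subspace_part: "subspace (G p)"
  using superspace by (simp add: superspace_def internal_direct_sum_def)

lemma V_eq: "V = {x + y | x y. x \<in> G 0 \<and> y \<in> G 1}"
  using superspace sum_of_subspaces_bit[of G] subspace_0[OF subspace_part]
  by (simp add: superspace_def internal_direct_sum_def)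

lemma parts_disjoint:
  assumes "x \<in> G p" "x \<in> G (p + 1)"
  shows "x = 0"
  using part_homogeneous[OF superspace, of x p] part_homogeneous[OF superspace, of x "p + 1"] assms
  by simp

text \<open>\<open>part\<close> is a definite description; exhibiting one decomposition evaluates
  it, since the two parts meet only in 0.\<close>

lemma part_unique:
  assumes "y \<in> G p" "x - y \<in> G (p + 1)"
  shows "part G p x = y"
  unfolding part_def
proof (rule the_equality)
  fix z assume z: "z \<in> G p \<and> x - z \<in> G (p + 1)"
  then have "z - y \<in> G p" using assms subspace_diff[OF subspace_part] by blast
  moreover have "z - y = (x - y) - (x - z)" by simp
  then have "z - y \<in> G (p + 1)" using assms z subspace_diff[OF subspace_part] by metis
  ultimately show "z = y" using parts_disjoint by force
qed (use assms in blast)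

lemma part_mem_and_diff:
  assumes "x \<in> V"
  shows "part G p x \<in> G p \<and> x - part G p x \<in> G (p + 1)"
proof -
  obtain y z where yz: "x = y + z" "y \<in> G 0" "z \<in> G 1" using assms by (auto simp: V_eq)
  have "part G 0 x = y" "part G 1 x = z" using yz by (auto intro: part_unique)
  then show ?thesis using yz by (cases p) auto
qed

lemma part_mem: "x \<in> V \<Longrightarrow> part G p x \<in> G p"
  using part_mem_and_diff by blast

lemma part_sum: "x \<in> V \<Longrightarrow> part G 0 x + part G 1 x = x"
proof -
  assume x: "x \<in> V"
  have "part G 1 x = x - part G 0 x"
    using part_mem_and_diff[OF x, of 0] by (intro part_unique) auto
  then show ?thesis by simp
qed

lemma part_add: "x \<in> V \<Longrightarrow> y \<in> V \<Longrightarrow> part G p (x + y) = part G p x + part G p y"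
proof (rule part_unique)
  assume x: "x \<in> V" and y: "y \<in> V"
  note px = part_mem_and_diff[OF x, of p] and py = part_mem_and_diff[OF y, of p]
  show "part G p x + part G p y \<in> G p"
    using px py subspace_add[OF subspace_part] by blast
  have "x + y - (part G p x + part G p y) = (x - part G p x) + (y - part G p y)" by simp
  then show "x + y - (part G p x + part G p y) \<in> G (p + 1)"
    using px py subspace_add[OF subspace_part] by metis
qed

lemma part_scale: "x \<in> V \<Longrightarrow> part G p (scl c x) = scl c (part G p x)"
proof (rule part_unique)
  assume x: "x \<in> V"
  note px = part_mem_and_diff[OF x, of p]
  show "scl c (part G p x) \<in> G p"
    using px subspace_scale[OF subspace_part] by blast
  show "scl c x - scl c (part G p x) \<in> G (p + 1)"
    using px subspace_scale[OF subspace_part] by (metis scale_right_diff_distrib)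
qed

lemma part_same: "x \<in> G p \<Longrightarrow> part G p x = x"
  and part_other: "x \<in> G p \<Longrightarrow> part G (p + 1) x = 0"
  using part_homogeneous[OF superspace] by auto

lemma part_cases:
  assumes "x \<in> G p"
  shows "part G q x = (if q = p then x else 0)"
  using part_same[OF assms] part_other[OF assms] by (cases p; cases q) auto

end

text \<open>The interior product i_a. On cochains it is the bracket with the constant
  \<open>a\<close> (\<open>W_bracket_const\<close>).\<close>

definition contract :: "'a \<Rightarrow> ('a list \<Rightarrow> 'b) \<Rightarrow> 'a list \<Rightarrow> 'b" where
  "contract a X vs = X (a # vs)"

lemma contract_plus [simp]: "contract a (X + Y) = contract a X + contract a Y"
  and contract_diff [simp]: "contract a (X' - Y') =
      contract a X' - (contract a Y' :: 'a list \<Rightarrow> 'b::group_add)"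
  and contract_0 [simp]: "contract a 0 = (0 :: 'a list \<Rightarrow> 'c::zero)"
  and contract_fscl [simp]: "contract a (fscl scl c Z) = fscl scl c (contract a Z)"
  by (simp_all add: contract_def fun_eq_iff fscl_def)

lemma fscl_apply [simp]: "fscl scl c X vs = scl c (X vs)"
  by (simp add: fscl_def)

lemma vector_space_fscl:
  assumes "vector_space scl"
  shows "vector_space (fscl scl)"
proof -
  interpret vector_space scl by fact
  show ?thesis
    by standard (simp_all add: fun_eq_iff scale_right_distrib scale_left_distrib)
qed

locale super_comm_assoc =
  fixes scl :: "'f::field_char_0 \<Rightarrow> 'a::ab_group_add \<Rightarrow> 'a"
    and A :: "bit \<Rightarrow> 'a set" and mul :: "'a \<Rightarrow> 'a \<Rightarrow> 'a"
  assumes comm_assoc: "comm_assoc_superalgebra scl UNIV A mul"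

sublocale super_comm_assoc \<subseteq> A: super_space scl UNIV A
proof -
  have "superspace scl UNIV A"
    using comm_assoc by (simp add: comm_assoc_superalgebra_def superalgebra_def)
  moreover from this have "vector_space scl" by (simp add: superspace_def)
  ultimately show "super_space scl UNIV A"
    by (simp add: super_space_def super_space_axioms_def)
qed

sublocale super_comm_assoc \<subseteq> F: vector_space "fscl scl"
  by (rule vector_space_fscl[OF A.vector_space_axioms])

context super_comm_assoc
begin

lemma mul_add_left: "mul (a + b) c = mul a c + mul b c"
  and mul_add_right: "mul a (b + c) = mul a b + mul a c"
  and mul_scale_left: "mul (scl r a) b = scl r (mul a b)"
  and mul_scale_right: "mul a (scl r b) = scl r (mul a b)"
  and mul_mem: "a \<in> A p \<Longrightarrow> b \<in> A q \<Longrightarrow> mul a b \<in> A (p + q)"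
  and mul_assoc: "mul (mul a b) c = mul a (mul b c)"
  and mul_comm: "a \<in> A p \<Longrightarrow> b \<in> A q \<Longrightarrow> mul a b = scl (psign (p * q)) (mul b a)"
  using comm_assoc unfolding comm_assoc_superalgebra_def superalgebra_def by blast+

lemma mul_0_left [simp]: "mul 0 a = 0" and mul_0_right [simp]: "mul a 0 = 0"
  using mul_add_left[of 0 0 a] mul_add_right[of a 0 0] by simp_all

lemma mul_minus_left: "mul (- a) b = - mul a b" and mul_minus_right: "mul a (- b) = - mul a b"
  using mul_scale_left[of "-1" a b] mul_scale_right[of a "-1" b] by simp_all

section \<open>Supersymmetric cochains of mixed degree\<close>

abbreviation W' where "W' \<equiv> W scl A"
abbreviation H where "H \<equiv> W_par scl A"

text \<open>The conditions of \<open>SHom\<close> without a fixed number of variables. They are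
  pointwise in the list of arguments, so an element of W can be handled without its decomposition
  into degrees.\<close>

definition smultilinear where
  "smultilinear = {X. (\<forall>us vs a b. X (us @ (a + b) # vs) = X (us @ a # vs) + X (us @ b # vs)) \<and>
     (\<forall>us vs c a. X (us @ scl c a # vs) = scl c (X (us @ a # vs))) \<and>
     (\<forall>p q. \<forall>a\<in>A p. \<forall>b\<in>A q. \<forall>us vs.
        X (us @ a # b # vs) = scl (psign (p * q)) (X (us @ b # a # vs)))}"

text \<open>A degree bound, strict so that \<open>vanish 0\<close> leaves only the zero cochain and
  a cochain in \<open>n\<close> variables satisfies \<open>vanish (Suc n)\<close>.\<close>

definition vanish :: "nat \<Rightarrow> ('a list \<Rightarrow> 'a) \<Rightarrow> bool" where
  "vanish n X \<longleftrightarrow> (\<forall>vs. n \<le> length vs \<longrightarrow> X vs = 0)"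

lemma smultilinearI:
  assumes "\<And>us vs a b. X (us @ (a + b) # vs) = X (us @ a # vs) + X (us @ b # vs)"
    and "\<And>us vs c a. X (us @ scl c a # vs) = scl c (X (us @ a # vs))"
    and "\<And>p q a b us vs. a \<in> A p \<Longrightarrow> b \<in> A q \<Longrightarrow>
      X (us @ a # b # vs) = scl (psign (p * q)) (X (us @ b # a # vs))"
  shows "X \<in> smultilinear"
  unfolding smultilinear_def using assms by blast

lemma smultilinear_lin_add: "X \<in> smultilinear \<Longrightarrow>
    X (us @ (a + b) # vs) = X (us @ a # vs) + X (us @ b # vs)"
  and smultilinear_lin_scale: "X \<in> smultilinear \<Longrightarrow> X (us @ scl c a # vs) = scl c (X (us @ a # vs))"
  and smultilinear_swap: "X \<in> smultilinear \<Longrightarrow> a \<in> A p \<Longrightarrow> b \<in> A q \<Longrightarrow>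
    X (us @ a # b # vs) = scl (psign (p * q)) (X (us @ b # a # vs))"
  unfolding smultilinear_def by blast+

lemma SHom_iff: "X \<in> SHom scl A n \<longleftrightarrow> X \<in> smultilinear \<and> (\<forall>vs. length vs \<noteq> n \<longrightarrow> X vs = 0)"
  unfolding SHom_def smultilinear_def Vector_Spaces.linear_iff mem_Collect_eq using
      A.vector_space_axioms by meson

lemma smultilinear_0: "0 \<in> smultilinear"
  by (rule smultilinearI) simp_all

lemma smultilinear_add:
  assumes "X \<in> smultilinear" "Y \<in> smultilinear"
  shows "X + Y \<in> smultilinear"
proof (rule smultilinearI)
  fix p q a b us vs assume "a \<in> A p" "b \<in> A q"
  then show "(X + Y) (us @ a # b # vs) = scl (psign (p * q)) ((X + Y) (us @ b # a # vs))"
    using assms by (simp add: smultilinear_swap[of _ a p b q] A.scale_right_distrib)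
qed (simp_all add: assms smultilinear_lin_add smultilinear_lin_scale A.scale_right_distrib)

lemma smultilinear_scale:
  assumes "X \<in> smultilinear"
  shows "fscl scl c X \<in> smultilinear"
proof (rule smultilinearI)
  fix p q a b us vs assume "a \<in> A p" "b \<in> A q"
  then show "fscl scl c X (us @ a # b # vs) = scl (psign (p * q)) (fscl scl c X (us @ b # a # vs))"
    using assms by (simp add: smultilinear_swap[of _ a p b q] mult.commute)
qed (simp_all add: assms smultilinear_lin_add smultilinear_lin_scale A.scale_right_distrib mult.commute)

lemma vanish_add: "vanish m X \<Longrightarrow> vanish n Y \<Longrightarrow> vanish (max m n) (X + Y)"
  by (simp add: vanish_def)

lemma vanish_scale: "vanish n X \<Longrightarrow> vanish n (fscl scl c X)"
  by (simp add: vanish_def)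

lemma smultilinear_length_part:
  assumes "X \<in> smultilinear"
  shows "(\<lambda>vs. if length vs = n then X vs else 0) \<in> SHom scl A n"
  unfolding SHom_iff
proof (intro conjI smultilinearI)
  fix p q a b us vs assume "a \<in> A p" "b \<in> A q"
  then show "(if length (us @ a # b # vs) = n then X (us @ a # b # vs) else 0) =
      scl (psign (p * q)) (if length (us @ b # a # vs) = n then X (us @ b # a # vs) else 0)"
    using smultilinear_swap[OF assms, of a p b q us vs] by simp
qed (simp_all add: smultilinear_lin_add[OF assms] smultilinear_lin_scale[OF assms])

lemma vanish_sum:
  assumes "vanish n X"
  shows "X = (\<Sum>i<n. (\<lambda>vs. if length vs = i then X vs else 0))"
proof
  fix vs
  have "(\<Sum>i<k. (\<lambda>vs. if length vs = i then X vs else 0)) vs =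
      (\<Sum>i<k. if length vs = i then X vs else 0)" for k
    by (induction k) simp_all
  then show "X vs = (\<Sum>i<n. (\<lambda>vs. if length vs = i then X vs else 0)) vs"
    using assms by (auto simp: vanish_def)
qed

text \<open>Restricting a supersymmetric multilinear function to lists of one length gives its
  component of that degree, and the bound makes the sum of the components finite.\<close>

lemma W_iff: "X \<in> W' \<longleftrightarrow> X \<in> smultilinear \<and> (\<exists>n. vanish n X)"
proof
  assume "X \<in> W'"
  then obtain I x where X: "X = (\<Sum>i\<in>I. x i)" and "finite I" and x: "\<forall>i\<in>I. x i \<in> SHom scl A i"
    by (auto simp: W_def sum_of_subspaces_def)
  from \<open>finite I\<close> x show "X \<in> smultilinear \<and> (\<exists>n. vanish n X)" unfolding X
  proof (induction I rule: finite_induct)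
    case (insert i I)
    then obtain n where n: "(\<Sum>i\<in>I. x i) \<in> smultilinear" "vanish n (\<Sum>i\<in>I. x i)" by auto
    have i: "x i \<in> smultilinear" "vanish (Suc i) (x i)"
        using insert.prems by (auto simp: SHom_iff vanish_def)
    show ?case
      unfolding sum.insert[OF insert.hyps(1,2)] using smultilinear_add[OF i(1) n(1)] vanish_add[OF
          i(2) n(2)] by blast
  qed (auto simp: smultilinear_0 vanish_def)
next
  assume "X \<in> smultilinear \<and> (\<exists>n. vanish n X)"
  then obtain n where X: "X \<in> smultilinear" "vanish n X" by blast
  have "\<forall>i\<in>{..<n}. (\<lambda>vs. if length vs = i then X vs else 0) \<in> SHom scl A i"
    using smultilinear_length_part[OF X(1)] by blast
  then show "X \<in> W'"
    using vanish_sum[OF X(2)] unfolding W_def sum_of_subspaces_def by blast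
qed

lemma W_0: "0 \<in> W'" and W_add: "X \<in> W' \<Longrightarrow> Y \<in> W' \<Longrightarrow> X + Y \<in> W'"
  and W_scale: "X \<in> W' \<Longrightarrow> fscl scl c X \<in> W'"
proof -
  have "vanish 0 0" by (simp add: vanish_def)
  then show "0 \<in> W'" using smultilinear_0 by (auto simp: W_iff)
  show "X \<in> W' \<Longrightarrow> Y \<in> W' \<Longrightarrow> X + Y \<in> W'"
    unfolding W_iff using smultilinear_add vanish_add by blast
  show "X \<in> W' \<Longrightarrow> fscl scl c X \<in> W'"
    unfolding W_iff using smultilinear_scale vanish_scale by blast
qed

lemma W_diff: "X \<in> W' \<Longrightarrow> Y \<in> W' \<Longrightarrow> X - Y \<in> W'"
  using W_add[of X "fscl scl (-1) Y"] W_scale[of Y "-1"] by simp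

lemma
  assumes "X \<in> W'"
  shows W_lin_add: "X (us @ (a + b) # vs) = X (us @ a # vs) + X (us @ b # vs)"
    and W_lin_scale: "X (us @ scl c a # vs) = scl c (X (us @ a # vs))"
    and W_swap: "a \<in> A p \<Longrightarrow> b \<in> A q \<Longrightarrow> X (us @ a # b # vs) = scl (psign (p * q)) (X (us @ b # a # vs))"
  using assms unfolding W_iff by (blast intro: smultilinear_lin_add smultilinear_lin_scale
      smultilinear_swap)+

lemma
  assumes "X \<in> W'"
  shows W_Cons_add: "X ((a + b) # vs) = X (a # vs) + X (b # vs)"
    and W_Cons_scale: "X (scl c a # vs) = scl c (X (a # vs))"
    and W_Cons_swap: "a \<in> A p \<Longrightarrow> b \<in> A q \<Longrightarrow> X (a # b # vs) = scl (psign (p * q)) (X (b # a # vs))"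
  by (rule W_lin_add[OF assms, of "[]", unfolded append_Nil]
      | rule W_lin_scale[OF assms, of "[]", unfolded append_Nil]
      | (rule W_swap[OF assms, of _ _ _ _ "[]", unfolded append_Nil]; assumption))+

lemma W_zero_arg: "X \<in> W' \<Longrightarrow> X (us @ 0 # vs) = 0"
  using W_lin_scale[of X us 0 0 vs] by simp

lemma W_split: "X \<in> W' \<Longrightarrow> X (us @ a # vs) = X (us @ part A 0 a # vs) + X (us @ part A 1 a # vs)"
  using W_lin_add[of X us "part A 0 a" "part A 1 a" vs] by (simp add: A.part_sum)

lemma contract_W: "X \<in> W' \<Longrightarrow> contract a X \<in> W'"
proof -
  assume X: "X \<in> W'"
  then obtain n where "vanish n X" by (auto simp: W_iff)
  then have "vanish n (contract a X)" by (simp add: vanish_def contract_def)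
  moreover have "contract a X \<in> smultilinear"
    using W_lin_add[OF X, of "a # us" for us] W_lin_scale[OF X, of "a # us" for us]
      W_swap[OF X, of _ _ _ _ "a # us" for us]
    unfolding contract_def append_Cons by (rule smultilinearI)
  ultimately show ?thesis by (auto simp: W_iff)
qed

lemma H_iff: "X \<in> H p \<longleftrightarrow> X \<in> W' \<and> (\<forall>ps vs. list_all2 (\<lambda>v q. v \<in> A q) vs ps \<longrightarrow> X vs \<in> A (p + sum_list ps))"
  by (simp add: W_par_def)

lemma H_W: "X \<in> H p \<Longrightarrow> X \<in> W'"
  by (simp add: H_iff)

lemma H_mem: "X \<in> H p \<Longrightarrow> list_all2 (\<lambda>v q. v \<in> A q) vs ps \<Longrightarrow> X vs \<in> A (p + sum_list ps)"
  by (simp add: H_iff)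

lemma H_contract:
  assumes "X \<in> H p" "a \<in> A s"
  shows "contract a X \<in> H (p + s)"
  using assms contract_W[of X a] H_mem[OF assms(1), of "a # _" "s # _"]
  by (simp add: H_iff contract_def add.assoc)

lemma H_Nil: "X \<in> H p \<Longrightarrow> X [] \<in> A p"
  and H_single: "X \<in> H p \<Longrightarrow> a \<in> A s \<Longrightarrow> X [a] \<in> A (p + s)"
  using H_mem[of X p "[]" "[]"] H_mem[of X p "[a]" "[s]"] by simp_all

lemma contract_add: "X \<in> W' \<Longrightarrow> contract (a + b) X = contract a X + contract b X"
  and contract_scale: "X \<in> W' \<Longrightarrow> contract (scl c a) X = fscl scl c (contract a X)"
  and contract_zero: "X \<in> W' \<Longrightarrow> contract 0 X = 0"
  using W_zero_arg[of X "[]"]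
  by (simp_all add: fun_eq_iff contract_def W_Cons_add W_Cons_scale)

lemma contract_swap: "X \<in> W' \<Longrightarrow> a \<in> A p \<Longrightarrow> b \<in> A q \<Longrightarrow>
    contract a (contract b X) = fscl scl (psign (p * q)) (contract b (contract a X))"
  by (auto simp: fun_eq_iff contract_def W_Cons_swap[of X b q a p] mult.commute)

text \<open>By multilinearity an argument may be replaced by its two parity components. The
  induction moves the arguments one by one from the arbitrary tail \<open>vs\<close> to the
  homogeneous front \<open>us\<close>.\<close>

lemma W_ext:
  assumes "X \<in> W'" "Y \<in> W'"
    and eq: "\<And>ps vs. list_all2 (\<lambda>v q. v \<in> A q) vs ps \<Longrightarrow> X vs = Y vs"
  shows "X = Y"
proof
  have "X (us @ vs) = Y (us @ vs)" if "list_all2 (\<lambda>v q. v \<in> A q) us ps" for us ps vs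
    using that
  proof (induction vs arbitrary: us ps)
    case (Cons a vs)
    have "X ((us @ [part A r a]) @ vs) = Y ((us @ [part A r a]) @ vs)" for r
      using Cons.prems A.part_mem[of a r] by (intro Cons.IH[of _ "ps @ [r]"]) (simp add:
          list_all2_appendI)
    then show ?case
      using W_split[OF assms(1), of us a vs] W_split[OF assms(2), of us a vs] by simp
  qed (use eq in simp)
  then show "X vs = Y vs" for vs using list_all2_Nil by (metis append_Nil)
qed

end

section \<open>Shuffle products of cochains\<close>

text \<open>
  The base values \<open>f X Y\<close> are \<open>X() Y()\<close> for the concatenation product and \<open>X(Y())\<close> for the
  box product. In \<open>shuffle_prod q X Y\<close> the bit \<open>q\<close> is the parity of \<open>Y\<close>.
\<close>

locale cochain_pairing = super_comm_assoc scl A mul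
  for scl :: "'f::field_char_0 \<Rightarrow> 'a::ab_group_add \<Rightarrow> 'a"
    and A :: "bit \<Rightarrow> 'a set" and mul :: "'a \<Rightarrow> 'a \<Rightarrow> 'a" +
  fixes f :: "('a list \<Rightarrow> 'a) \<Rightarrow> ('a list \<Rightarrow> 'a) \<Rightarrow> 'a"
  assumes f_add_left: "X \<in> W' \<Longrightarrow> X' \<in> W' \<Longrightarrow> Y \<in> W' \<Longrightarrow> f (X + X') Y = f X Y + f X' Y"
    and f_add_right: "X \<in> W' \<Longrightarrow> Y \<in> W' \<Longrightarrow> Y' \<in> W' \<Longrightarrow> f X (Y + Y') = f X Y + f X Y'"
    and f_scale_left: "X \<in> W' \<Longrightarrow> Y \<in> W' \<Longrightarrow> f (fscl scl c X) Y = scl c (f X Y)"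
    and f_scale_right: "X \<in> W' \<Longrightarrow> Y \<in> W' \<Longrightarrow> f X (fscl scl c Y) = scl c (f X Y)"
    and f_mem: "X \<in> H p \<Longrightarrow> Y \<in> H q \<Longrightarrow> f X Y \<in> A (p + q)"
begin

text \<open>The contraction rule taken as a definition, extended linearly to inhomogeneous
  \<open>a\<close>. Passing \<open>q\<close> separately keeps the product linear in Y, and the
  recursive calls can record that contraction shifts the parity of Y by \<open>s\<close>.\<close>

primrec shuffle_prod :: "bit \<Rightarrow> ('a list \<Rightarrow> 'a) \<Rightarrow> ('a list \<Rightarrow> 'a) \<Rightarrow> 'a list \<Rightarrow> 'a" where
  "shuffle_prod q X Y [] = f X Y"
| "shuffle_prod q X Y (a # vs) = (\<Sum>s\<in>{0, 1}. shuffle_prod (q + s) X (contract (part A s a) Y) vs +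
    scl (psign (s * q)) (shuffle_prod q (contract (part A s a) X) Y vs))"

lemma shuffle_prod_add_left: "X \<in> W' \<Longrightarrow> X' \<in> W' \<Longrightarrow> Y \<in> W' \<Longrightarrow>
    shuffle_prod q (X + X') Y = shuffle_prod q X Y + shuffle_prod q X' Y"
proof
  fix vs show "X \<in> W' \<Longrightarrow> X' \<in> W' \<Longrightarrow> Y \<in> W' \<Longrightarrow> shuffle_prod q (X + X') Y vs =
      (shuffle_prod q X Y + shuffle_prod q X' Y) vs"
    by (induction vs arbitrary: q X X' Y)
      (simp_all add: f_add_left contract_W A.scale_right_distrib)
qed

lemma shuffle_prod_add_right: "X \<in> W' \<Longrightarrow> Y \<in> W' \<Longrightarrow> Y' \<in> W' \<Longrightarrow>
    shuffle_prod q X (Y + Y') = shuffle_prod q X Y + shuffle_prod q X Y'"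
proof
  fix vs show "X \<in> W' \<Longrightarrow> Y \<in> W' \<Longrightarrow> Y' \<in> W' \<Longrightarrow> shuffle_prod q X (Y + Y') vs =
      (shuffle_prod q X Y + shuffle_prod q X Y') vs"
    by (induction vs arbitrary: q X Y Y')
      (simp_all add: f_add_right contract_W A.scale_right_distrib)
qed

lemma shuffle_prod_scale_left: "X \<in> W' \<Longrightarrow> Y \<in> W' \<Longrightarrow>
    shuffle_prod q (fscl scl c X) Y = fscl scl c (shuffle_prod q X Y)"
proof
  fix vs show "X \<in> W' \<Longrightarrow> Y \<in> W' \<Longrightarrow> shuffle_prod q (fscl scl c X) Y vs = fscl scl c (shuffle_prod q X Y) vs"
    by (induction vs arbitrary: q X Y)
      (simp_all add: f_scale_left contract_W A.scale_right_distrib mult.commute)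
qed

lemma shuffle_prod_scale_right: "X \<in> W' \<Longrightarrow> Y \<in> W' \<Longrightarrow>
    shuffle_prod q X (fscl scl c Y) = fscl scl c (shuffle_prod q X Y)"
proof
  fix vs show "X \<in> W' \<Longrightarrow> Y \<in> W' \<Longrightarrow> shuffle_prod q X (fscl scl c Y) vs = fscl scl c (shuffle_prod q X Y) vs"
    by (induction vs arbitrary: q X Y)
      (simp_all add: f_scale_right contract_W A.scale_right_distrib mult.commute)
qed

lemma shuffle_prod_0_left: "Y \<in> W' \<Longrightarrow> shuffle_prod q 0 Y = 0"
  and shuffle_prod_0_right: "X \<in> W' \<Longrightarrow> shuffle_prod q X 0 = 0"
  using shuffle_prod_scale_left[of 0 Y q 0] shuffle_prod_scale_right[of X 0 q 0] by (simp_all add: W_0)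

lemma contract_shuffle_prod:
  assumes "X \<in> W'" "Y \<in> W'" "a \<in> A s"
  shows "contract a (shuffle_prod q X Y) =
    shuffle_prod (q + s) X (contract a Y) + fscl scl (psign (s * q)) (shuffle_prod q (contract a X) Y)"
  using assms by (cases s)
    (simp_all add: fun_eq_iff contract_def[of a "shuffle_prod q X Y"] A.part_cases contract_zero
        shuffle_prod_0_left shuffle_prod_0_right)

lemma shuffle_prod_Cons:
  assumes "X \<in> W'" "Y \<in> W'" "a \<in> A s"
  shows "shuffle_prod q X Y (a # vs) =
    shuffle_prod (q + s) X (contract a Y) vs + scl (psign (s * q)) (shuffle_prod q (contract a X) Y vs)"
  using contract_shuffle_prod[OF assms, of q] by
    (simp add: contract_def[of a "shuffle_prod q X Y"] fun_eq_iff)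

text \<open>The recursion strips the prefix \<open>us\<close> from both sides, so only arguments at
  the head of the list need a computation.\<close>

lemma shuffle_prod_smultilinear:
  assumes "X \<in> W'" "Y \<in> W'"
  shows "shuffle_prod q X Y \<in> smultilinear"
proof (rule smultilinearI)
  fix us vs :: "'a list" and a b c
  show "shuffle_prod q X Y (us @ (a + b) # vs) =
      shuffle_prod q X Y (us @ a # vs) + shuffle_prod q X Y (us @ b # vs)"
    using assms
  proof (induction us arbitrary: q X Y)
    case Nil
    then show ?case
      by (simp add: A.part_add contract_add contract_W shuffle_prod_add_left
          shuffle_prod_add_right A.scale_right_distrib)
  next
    case (Cons u us)
    then show ?case by (simp add: contract_W A.scale_right_distrib)
  qed
  show "shuffle_prod q X Y (us @ scl c a # vs) = scl c (shuffle_prod q X Y (us @ a # vs))"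
    using assms
  proof (induction us arbitrary: q X Y)
    case Nil
    then show ?case
      by (simp add: A.part_scale contract_scale contract_W shuffle_prod_scale_left
          shuffle_prod_scale_right
          A.scale_right_distrib mult.commute)
  next
    case (Cons u us)
    then show ?case by (simp add: contract_W A.scale_right_distrib mult.commute)
  qed
next
  fix s t a b and us vs :: "'a list" assume a: "a \<in> A s" and b: "b \<in> A t"
  show "shuffle_prod q X Y (us @ a # b # vs) =
      scl (psign (s * t)) (shuffle_prod q X Y (us @ b # a # vs))"
    using assms
  proof (induction us arbitrary: q X Y)
    case Nil
    \<comment> \<open>Two steps of the recursion give four terms on each side. Where both
      contractions hit the same factor, \<open>swap\<close> exchanges them; the two mixed terms
      correspond to each other directly.\<close>
    note swap = contract_swap[OF _ b a]
    show ?case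
      unfolding append_Nil
      by (simp add: shuffle_prod_Cons[OF _ _ a] shuffle_prod_Cons[OF _ _ b] Nil contract_W swap
          shuffle_prod_scale_left shuffle_prod_scale_right
          del: shuffle_prod.simps(2))
        (cases s; cases t; cases q; simp add: algebra_simps)
  next
    case (Cons u us)
    then show ?case by (simp add: contract_W A.scale_right_distrib mult.commute)
  qed
qed

text \<open>Each step of the recursion contracts one factor and so lowers one of the two bounds by
  one; once a bound is 0, that factor and hence the product is zero.\<close>

lemma shuffle_prod_vanish:
  assumes "vanish m X" "vanish n Y" "X \<in> W'" "Y \<in> W'"
  shows "vanish (m + n) (shuffle_prod q X Y)"
proof -
  have "shuffle_prod q X Y vs = 0" if "m + n \<le> length vs" for vs
    using assms that
  proof (induction vs arbitrary: m n q X Y)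
    case Nil
    then have "X = 0" by (auto simp: vanish_def fun_eq_iff)
    then show ?case using shuffle_prod_0_left[of Y q] Nil.prems by (metis zero_fun_apply)
  next
    case (Cons a vs)
    show ?case
    proof (cases "m = 0 \<or> n = 0")
      case True
      then have "X = 0 \<or> Y = 0" using Cons.prems(1,2) by (auto simp: vanish_def fun_eq_iff)
      then show ?thesis using shuffle_prod_0_left[of Y q] shuffle_prod_0_right[of X q] Cons.prems
          by (metis zero_fun_apply)
    next
      case False
      have X: "vanish (m - 1) (contract b X)" and Y: "vanish (n - 1) (contract b Y)" for b
        using Cons.prems(1,2) by (auto simp: vanish_def contract_def)
      have "shuffle_prod r X (contract b Y) vs = 0" "shuffle_prod r (contract b X) Y vs = 0" for r b
        using Cons.IH[OF Cons.prems(1) Y Cons.prems(3) contract_W[OF Cons.prems(4)]]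
          Cons.IH[OF X Cons.prems(2) contract_W[OF Cons.prems(3)] Cons.prems(4)]
          False Cons.prems(5) by simp_all
      then show ?thesis by simp
    qed
  qed
  then show ?thesis by (simp add: vanish_def)
qed

lemma shuffle_prod_W: "X \<in> W' \<Longrightarrow> Y \<in> W' \<Longrightarrow> shuffle_prod q X Y \<in> W'"
  using shuffle_prod_smultilinear shuffle_prod_vanish by (metis W_iff)

lemma shuffle_prod_H:
  assumes "X \<in> H p" "Y \<in> H q"
  shows "shuffle_prod q X Y \<in> H (p + q)"
  unfolding H_iff
proof (intro conjI allI impI)
  show "shuffle_prod q X Y \<in> W'" using assms by (simp add: shuffle_prod_W H_W)
  fix ps vs assume "list_all2 (\<lambda>v q. v \<in> A q) vs ps"
  then show "shuffle_prod q X Y vs \<in> A (p + q + sum_list ps)"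
    using assms
  proof (induction arbitrary: p q X Y rule: list_all2_induct)
    case Nil
    then show ?case by (simp add: f_mem)
  next
    case (Cons a vs s ps)
    have "shuffle_prod (q + s) X (contract a Y) vs \<in> A (p + (q + s) + sum_list ps)"
      "shuffle_prod q (contract a X) Y vs \<in> A (p + s + q + sum_list ps)"
      using Cons by (blast intro: Cons.IH H_contract)+
    then show ?case
      using Cons by (simp add: shuffle_prod_Cons H_W add_ac A.subspace_add A.subspace_scale
          A.subspace_part
          del: shuffle_prod.simps(2))
  qed
qed

end

section \<open>The given products as shuffle products\<close>

lemma hom_ext_Cons:
  "hom_ext A F (a # vs) = (\<Sum>s\<in>{0, 1}. hom_ext A (\<lambda>ps ws. F (s # ps) (part A s a # ws)) vs)"
proof -
  have "{ps :: bit list. length ps = Suc n} = (\<lambda>(s, ps). s # ps) ` ({0, 1} \<times> {ps. length ps = n})" for n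
    by (auto simp: length_Suc_conv image_iff UNIV_bit[symmetric])
  moreover have "inj_on (\<lambda>(s, ps). s # ps) S" for S :: "(bit \<times> bit list) set"
    by (auto simp: inj_on_def)
  ultimately show ?thesis
    unfolding hom_ext_def
    by (simp only: list.size(4) add_Suc_right add_0_right)
      (simp add: sum.reindex sum.cartesian_product' case_prod_unfold)
qed

lemma hom_ext_Nil: "hom_ext A F [] = F [] []"
  by (simp add: hom_ext_def)

context super_comm_assoc
begin

lemma hom_ext_cong:
  assumes "\<And>ps ws. length ps = length vs \<Longrightarrow> length ws = length vs \<Longrightarrow>
    list_all2 (\<lambda>v q. v \<in> A q) ws ps \<Longrightarrow> F ps ws = G ps ws"
  shows "hom_ext A F vs = hom_ext A G vs"
  unfolding hom_ext_def
  by (intro sum.cong assms) (auto simp: list_all2_conv_all_nth A.part_mem)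

lemma hom_ext_add: "hom_ext A (\<lambda>ps ws. F ps ws + G ps ws) vs = hom_ext A F vs + hom_ext A G vs"
  and hom_ext_scale: "hom_ext A (\<lambda>ps ws. scl c (F ps ws)) vs = scl c (hom_ext A F vs)"
  by (simp_all add: hom_ext_def sum.distrib A.scale_sum_right)

end

sublocale super_comm_assoc \<subseteq> C: cochain_pairing scl A mul "\<lambda>X Y. mul (X []) (Y [])"
  by standard (simp_all add: mul_add_left mul_add_right mul_scale_left mul_scale_right mul_mem H_Nil)

sublocale super_comm_assoc \<subseteq> B: cochain_pairing scl A mul "\<lambda>X Y. X [Y []]"
  by standard (simp_all add: W_Cons_add W_Cons_scale H_single H_Nil)

context super_comm_assoc
begin

text \<open>The multilinear extension of \<open>shuffle_sum_Cons\<close> is the recursion that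
  defines \<open>shuffle_prod\<close>.\<close>

lemma hom_ext_shuffle_sum_mul:
  "hom_ext A (shuffle_sum scl q (\<lambda>us ws. mul (X us) (Y ws))) vs = C.shuffle_prod q X Y vs"
proof (induction vs arbitrary: q X Y)
  case (Cons a vs)
  have "hom_ext A (shuffle_sum scl q (\<lambda>us ws. mul (X us) (Y ws))) (a # vs) =
      (\<Sum>s\<in>{0, 1}. hom_ext A (\<lambda>ps ws.
        scl (psign (s * q)) (shuffle_sum scl q (\<lambda>us ws. mul (contract (part A s a) X us) (Y ws)) ps ws) +
        shuffle_sum scl (q + s) (\<lambda>us ws. mul (X us) (contract (part A s a) Y ws)) ps ws) vs)"
    unfolding hom_ext_Cons contract_def
    by (intro sum.cong refl hom_ext_cong) (simp add: A.shuffle_sum_Cons)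
  then show ?case
    by (simp add: hom_ext_add hom_ext_scale Cons.IH add_ac)
qed (simp add: hom_ext_Nil)

text \<open>Exchanging \<open>a\<close> with \<open>Y us\<close> inside X gives the sign of
  \<open>s\<close> against \<open>q\<close> plus the parities of \<open>us\<close>. The contribution
  of \<open>us\<close> cancels the twist \<open>s\<close> of the shuffle sum, and the sign of
  \<open>s * q\<close> remains.\<close>

lemma shuffle_sum_box_move:
  assumes X: "X \<in> W'" and Y: "Y \<in> H q" and a: "a \<in> A s"
    and vs: "list_all2 (\<lambda>v q. v \<in> A q) vs ps"
  shows "shuffle_sum scl s (\<lambda>us ws. X (Y us # a # ws)) ps vs =
    scl (psign (s * q)) (shuffle_sum scl 0 (\<lambda>us ws. X (a # Y us # ws)) ps vs)"
  unfolding shuffle_sum_def A.scale_sum_right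
proof (intro sum.cong refl)
  fix m \<pi> assume m: "m \<in> {..length vs}" and "\<pi> \<in> shuffle_perms m (length vs)"
  then have \<pi>: "\<pi> permutes {..<length vs}" by (simp add: shuffle_perms_permutes)
  let ?us = "map (\<lambda>s. vs ! \<pi> s) [0..<m]" and ?ws = "map (\<lambda>s. vs ! \<pi> s) [m..<length vs]"
  let ?c = "\<Sum>s<m. ps ! \<pi> s"
  have "list_all2 (\<lambda>v q. v \<in> A q) ?us (map (\<lambda>s. ps ! \<pi> s) [0..<m])"
    using m vs permutes_in_image[OF \<pi>] by (auto simp: list_all2_conv_all_nth)
  from H_mem[OF Y this] have "Y ?us \<in> A (q + ?c)"
    by (simp add: interv_sum_list_conv_sum_set_nat atLeast0LessThan)
  from W_Cons_swap[OF X this a]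
  have "X (Y ?us # a # ?ws) = scl (psign ((q + ?c) * s)) (X (a # Y ?us # ?ws))" .
  moreover have "psign (s * ?c) * psign ((q + ?c) * s) = (psign (s * q) :: 'f)"
    by (cases s; cases q; cases ?c; simp)
  ultimately show "scl (perm_sign ps \<pi> * psign (s * ?c)) (X (Y ?us # a # ?ws)) =
      scl (psign (s * q)) (scl (perm_sign ps \<pi> * psign (0 * ?c)) (X (a # Y ?us # ?ws)))"
    by (simp add: mult.assoc mult.commute[of "psign (s * q)"])
qed

text \<open>When the first argument enters the second block, \<open>shuffle_sum_Cons\<close> twists
  the sum by \<open>s\<close>. \<open>shuffle_sum_box_move\<close> removes the twist, so that the
  recursion returns to untwisted sums, that is, to box products.\<close>

lemma box_eq_shuffle_prod:
  "X \<in> W' \<Longrightarrow> Y \<in> H q \<Longrightarrow> box scl A X Y vs = B.shuffle_prod q X Y vs"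
proof -
  have eq: "box scl A X Y = hom_ext A (shuffle_sum scl 0 (\<lambda>us ws. X (Y us # ws)))" for X Y
    by (simp add: box_def shuffle_sum_def[abs_def] Let_def)
  show "X \<in> W' \<Longrightarrow> Y \<in> H q \<Longrightarrow> box scl A X Y vs = B.shuffle_prod q X Y vs"
  proof (induction vs arbitrary: q X Y)
    case (Cons a vs)
    have mem: "part A s a \<in> A s" for s by (simp add: A.part_mem)
    have "box scl A X Y (a # vs) =
        (\<Sum>s\<in>{0, 1}. hom_ext A (\<lambda>ps ws.
          shuffle_sum scl 0 (\<lambda>us ws. X (contract (part A s a) Y us # ws)) ps ws +
          scl (psign (s * q)) (shuffle_sum scl 0
            (\<lambda>us ws. contract (part A s a) X (Y us # ws)) ps ws)) vs)"
      unfolding eq hom_ext_Cons contract_def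
    proof (intro sum.cong refl hom_ext_cong)
      fix s ps ws assume "length ps = length vs" "length ws = length vs"
        and "list_all2 (\<lambda>v q. v \<in> A q) ws ps"
      then show "shuffle_sum scl 0 (\<lambda>us ws. X (Y us # ws)) (s # ps) (part A s a # ws) =
          shuffle_sum scl 0 (\<lambda>us ws. X (Y (part A s a # us) # ws)) ps ws +
          scl (psign (s * q)) (shuffle_sum scl 0 (\<lambda>us ws. X (part A s a # Y us # ws)) ps ws)"
        using shuffle_sum_box_move[OF Cons.prems mem] by (simp add: A.shuffle_sum_Cons)
    qed
    moreover have "box scl A X (contract (part A s a) Y) vs =
        B.shuffle_prod (q + s) X (contract (part A s a) Y) vs" for s
      by (intro Cons.IH H_contract mem Cons.prems)
    from this[of 0] this[of 1]
    have "box scl A X (contract (part A 0 a) Y) vs = B.shuffle_prod q X (contract (part A 0 a) Y) vs"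
      "box scl A X (contract (part A 1 a) Y) vs = B.shuffle_prod (q + 1) X (contract (part A 1 a) Y) vs"
      by simp_all
    ultimately show ?case
      using Cons.prems by (simp add: hom_ext_add hom_ext_scale eq[symmetric] Cons.IH contract_W add_ac)
  qed (simp add: eq hom_ext_Nil)
qed

end

section \<open>The identities for homogeneous cochains\<close>

context super_comm_assoc
begin

abbreviation hom_concat where "hom_concat \<equiv> C.shuffle_prod"
abbreviation hom_box where "hom_box \<equiv> B.shuffle_prod"

text \<open>The bits \<open>p\<close> and \<open>q\<close> are the parities of \<open>X\<close> and \<open>Y\<close>.\<close>

definition hom_bracket :: "bit \<Rightarrow> bit \<Rightarrow> ('a list \<Rightarrow> 'a) \<Rightarrow> ('a list \<Rightarrow> 'a) \<Rightarrow> 'a list \<Rightarrow> 'a" where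
  "hom_bracket p q X Y = hom_box q X Y - fscl scl (psign (p * q)) (hom_box p Y X)"

lemma fscl_distrib: "fscl scl c (X + Y) = fscl scl c X + fscl scl c Y"
  and fscl_diff: "fscl scl c (X - Y) = fscl scl c X - fscl scl c Y"
  and fscl_fscl: "fscl scl c (fscl scl d X) = fscl scl (c * d) X"
  by (simp_all add: fun_eq_iff A.scale_right_distrib A.scale_right_diff_distrib)

lemma mul_diff_left: "mul (a - b) c = mul a c - mul b c"
    and mul_diff_right: "mul a (b - c) = mul a b - mul a c"
  using mul_add_left[of a "- b" c] mul_add_right[of a b "- c"] by (simp_all add: mul_minus_left
      mul_minus_right)

lemma hom_bracket_W: "X \<in> W' \<Longrightarrow> Y \<in> W' \<Longrightarrow> hom_bracket p q X Y \<in> W'"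
  by (simp add: hom_bracket_def W_diff W_scale B.shuffle_prod_W)

lemma H_add: "X \<in> H p \<Longrightarrow> Y \<in> H p \<Longrightarrow> X + Y \<in> H p"
  and H_scale: "X \<in> H p \<Longrightarrow> fscl scl c X \<in> H p"
  and H_0: "0 \<in> H p"
  by (auto simp: H_iff W_add W_scale W_0 A.subspace_add A.subspace_scale A.subspace_0 A.subspace_part)

lemma H_diff: "X \<in> H p \<Longrightarrow> Y \<in> H p \<Longrightarrow> X - Y \<in> H p"
  using H_add[of X p "fscl scl (-1) Y"] H_scale[of Y p "-1"] by simp

lemma hom_bracket_H: "X \<in> H p \<Longrightarrow> Y \<in> H q \<Longrightarrow> hom_bracket p q X Y \<in> H (p + q)"
  unfolding hom_bracket_def using B.shuffle_prod_H[of X p Y q] B.shuffle_prod_H[of Y q X p]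
  by (intro H_diff H_scale) (simp_all add: add.commute)

lemma hom_bracket_add_left: "X \<in> W' \<Longrightarrow> X' \<in> W' \<Longrightarrow> Y \<in> W' \<Longrightarrow>
    hom_bracket p q (X + X') Y = hom_bracket p q X Y + hom_bracket p q X' Y"
  and hom_bracket_add_right: "X \<in> W' \<Longrightarrow> Y \<in> W' \<Longrightarrow> Y' \<in> W' \<Longrightarrow>
      hom_bracket p q X (Y + Y') = hom_bracket p q X Y + hom_bracket p q X Y'"
  and hom_bracket_scale_left: "X \<in> W' \<Longrightarrow> Y \<in> W' \<Longrightarrow>
      hom_bracket p q (fscl scl c X) Y = fscl scl c (hom_bracket p q X Y)"
  and hom_bracket_scale_right: "X \<in> W' \<Longrightarrow> Y \<in> W' \<Longrightarrow>
      hom_bracket p q X (fscl scl c Y) = fscl scl c (hom_bracket p q X Y)"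
  by (simp_all add: hom_bracket_def B.shuffle_prod_add_left B.shuffle_prod_add_right
      B.shuffle_prod_scale_left B.shuffle_prod_scale_right
      fscl_distrib fscl_diff fscl_fscl mult.commute del: fscl_apply)

lemma hom_bracket_0_left: "Y \<in> W' \<Longrightarrow> hom_bracket p q 0 Y = 0"
  and hom_bracket_0_right: "X \<in> W' \<Longrightarrow> hom_bracket p q X 0 = 0"
  by (simp_all add: hom_bracket_def B.shuffle_prod_0_left B.shuffle_prod_0_right fun_eq_iff)

text \<open>In the second box product the factors are interchanged, so contracting Y gives the sign
  of \<open>s * p\<close> there; with the sign of \<open>p * q\<close> it becomes that of
  \<open>p * (q + s)\<close>, as required for a bracket with parity \<open>q + s\<close>. The other
  term is similar.\<close>

lemma contract_hom_bracket:
  assumes "X \<in> W'" "Y \<in> W'" "a \<in> A s"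
  shows "contract a (hom_bracket p q X Y) =
    hom_bracket p (q + s) X (contract a Y) +
      fscl scl (psign (s * q)) (hom_bracket (p + s) q (contract a X) Y)"
  unfolding hom_bracket_def
  by (simp add: B.contract_shuffle_prod[OF _ _ assms(3)] assms fun_eq_iff)
    (cases p; cases q; cases s; simp add: algebra_simps)

lemma contract_Cons: "X (a # vs) = contract a X vs"
  by (simp add: contract_def)

lemma hom_bracket_Nil: "hom_bracket p q X Y [] = X [Y []] - scl (psign (p * q)) (Y [X []])"
  by (simp add: hom_bracket_def)

text \<open>One step beyond the empty list. Supersymmetry puts the value of the other cochain before
  \<open>c\<close>, which leaves \<open>c\<close> in the last place where the derivation condition
  applies.\<close>

lemma hom_bracket_single:
  assumes X: "X \<in> H p" and Y: "Y \<in> H q" and c: "c \<in> A s"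
  shows "hom_bracket p q X Y [c] = X [Y [c]] + X [Y [], c] -
      scl (psign (p * q)) (Y [X [c]] + Y [X [], c])"
proof -
  note W = X[THEN H_W] Y[THEN H_W]
  have "hom_bracket p q X Y [c] = X [Y [c]] - scl (psign (p * (q + s))) (Y [c, X []]) +
      scl (psign (s * q)) (X [c, Y []] - scl (psign ((p + s) * q)) (Y [X [c]]))"
    by (simp only: contract_Cons[of "hom_bracket p q X Y"] contract_hom_bracket[OF W c]
        plus_fun_apply fscl_apply hom_bracket_Nil contract_def)
  also have "Y [c, X []] = scl (psign (s * p)) (Y [X [], c])"
    using W_Cons_swap[OF W(2) c H_Nil[OF X]] .
  also have "X [c, Y []] = scl (psign (s * q)) (X [Y [], c])"
    using W_Cons_swap[OF W(1) c H_Nil[OF Y]] .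
  finally show ?thesis
    by (simp only:) (cases p; cases q; cases s; simp add: algebra_simps)
qed

lemma hom_bracket_Cons:
  assumes "X \<in> W'" "Y \<in> W'" "a \<in> A s"
  shows "hom_bracket p q X Y (a # vs) =
    hom_bracket p (q + s) X (contract a Y) vs +
      scl (psign (s * q)) (hom_bracket (p + s) q (contract a X) Y vs)"
  by (simp add: contract_Cons[of "hom_bracket p q X Y"] contract_hom_bracket[OF assms])

lemma W_diff_arg: "X \<in> W' \<Longrightarrow> X ((a - b) # vs) = X (a # vs) - X (b # vs)"
  using W_Cons_add[of X a "scl (-1) b" vs] W_Cons_scale[of X "-1" b vs] by simp

section \<open>Associativity, commutativity and the Jacobi identity\<close>

lemma hom_bracket_skew: "hom_bracket p q X Y = - fscl scl (psign (p * q)) (hom_bracket q p Y X)"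
  by (simp add: hom_bracket_def fun_eq_iff) (cases p; cases q; simp)

text \<open>Both sides expand into the contractions of Z, of Y and of X. The parity of X enters
  neither side, so contracting X leaves \<open>q\<close> and \<open>r\<close> as they are.\<close>

lemma hom_concat_assoc:
  assumes "X \<in> W'" "Y \<in> H q" "Z \<in> H r"
  shows "hom_concat r (hom_concat q X Y) Z = hom_concat (q + r) X (hom_concat r Y Z)"
proof (rule W_ext)
  fix ps vs assume "list_all2 (\<lambda>v q. v \<in> A q) vs ps"
  then show "hom_concat r (hom_concat q X Y) Z vs = hom_concat (q + r) X (hom_concat r Y Z) vs"
    using assms
  proof (induction arbitrary: q r X Y Z rule: list_all2_induct)
    case Nil
    then show ?case by (simp add: mul_assoc)
  next
    case (Cons a vs s ps)
    note a = Cons.hyps(1) and X = Cons.prems(1) and Y = Cons.prems(2) and Z = Cons.prems(3)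
    note W = X Y[THEN H_W] Z[THEN H_W]
    note IH1 = Cons.IH[OF X Y H_contract[OF Z a]]
      and IH2 = Cons.IH[OF X H_contract[OF Y a] Z]
      and IH3 = Cons.IH[OF contract_W[OF X] Y Z, of a]
    note simps = C.shuffle_prod_Cons[OF _ _ a] C.contract_shuffle_prod[OF _ _ a] W
        C.shuffle_prod_W contract_W W_scale
      C.shuffle_prod_add_left C.shuffle_prod_scale_left C.shuffle_prod_add_right
          C.shuffle_prod_scale_right
    have 1: "hom_concat r (hom_concat q X Y) Z (a # vs) =
        hom_concat (r + s) (hom_concat q X Y) (contract a Z) vs +
        scl (psign (s * r)) (hom_concat r (hom_concat (q + s) X (contract a Y)) Z vs +
          scl (psign (s * q)) (hom_concat r (hom_concat q (contract a X) Y) Z vs))"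
      by (simp add: simps del: C.shuffle_prod.simps(2))
    have 2: "hom_concat (q + r) X (hom_concat r Y Z) (a # vs) =
        hom_concat (q + (r + s)) X (hom_concat (r + s) Y (contract a Z)) vs +
        scl (psign (s * r)) (hom_concat (q + s + r) X (hom_concat r (contract a Y) Z) vs) +
        scl (psign (s * (q + r))) (hom_concat (q + r) (contract a X) (hom_concat r Y Z) vs)"
      by (simp add: simps del: C.shuffle_prod.simps(2)) (simp add: add_ac del: C.shuffle_prod.simps(2))
    show ?case
      unfolding 1 2 IH1 IH2 IH3
      by (cases q; cases r; cases s; simp add: algebra_simps del: C.shuffle_prod.simps(2))
  qed
qed (use assms in \<open>simp_all add: C.shuffle_prod_W H_W\<close>)

lemma hom_concat_comm:
  assumes "X \<in> H p" "Y \<in> H q"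
  shows "hom_concat q X Y = fscl scl (psign (p * q)) (hom_concat p Y X)"
proof (rule W_ext)
  fix ps vs assume "list_all2 (\<lambda>v q. v \<in> A q) vs ps"
  then show "hom_concat q X Y vs = fscl scl (psign (p * q)) (hom_concat p Y X) vs"
    using assms
  proof (induction arbitrary: p q X Y rule: list_all2_induct)
    case Nil
    show ?case by (simp add: mul_comm[OF H_Nil[OF Nil(1)] H_Nil[OF Nil(2)]])
  next
    case (Cons a vs s ps)
    note a = Cons.hyps(1) and X = Cons.prems(1) and Y = Cons.prems(2)
    note W = X[THEN H_W] Y[THEN H_W]
    note IH1 = Cons.IH[OF X H_contract[OF Y a]] and IH2 = Cons.IH[OF H_contract[OF X a] Y]
    show ?case
      by (simp add: C.shuffle_prod_Cons[OF _ _ a] W IH1 IH2 del: C.shuffle_prod.simps(2))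
        (cases p; cases q; cases s; simp add: algebra_simps del: C.shuffle_prod.simps(2))
  qed
qed (use assms in \<open>simp_all add: C.shuffle_prod_W H_W W_scale\<close>)

text \<open>The bracket itself obeys the contraction rule, so the identity is proved for it
  directly, without any associator identity for the box product.\<close>

lemma hom_bracket_jacobi:
  assumes "X \<in> H p" "Y \<in> H q" "Z \<in> H r"
  shows "hom_bracket p (q + r) X (hom_bracket q r Y Z) =
    hom_bracket (p + q) r (hom_bracket p q X Y) Z +
      fscl scl (psign (p * q)) (hom_bracket q (p + r) Y (hom_bracket p r X Z))"
proof (rule W_ext)
  fix ps vs assume "list_all2 (\<lambda>v q. v \<in> A q) vs ps"
  then show "hom_bracket p (q + r) X (hom_bracket q r Y Z) vs =
    (hom_bracket (p + q) r (hom_bracket p q X Y) Z +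
      fscl scl (psign (p * q)) (hom_bracket q (p + r) Y (hom_bracket p r X Z))) vs"
    using assms
  proof (induction arbitrary: p q r X Y Z rule: list_all2_induct)
    case Nil
    note X = Nil(1) and Y = Nil(2) and Z = Nil(3)
    note W = X[THEN H_W] Y[THEN H_W] Z[THEN H_W]
    \<comment> \<open>At the empty list the outer brackets evaluate the inner ones at one argument,
      which produces terms with two arguments. They come in three pairs that differ by the order of
      the arguments and cancel by supersymmetry.\<close>
    have swaps: "Z [X [], Y []] = scl (psign (p * q)) (Z [Y [], X []])"
      "Y [X [], Z []] = scl (psign (p * r)) (Y [Z [], X []])"
      "X [Y [], Z []] = scl (psign (q * r)) (X [Z [], Y []])"
      using W[THEN W_Cons_swap] H_Nil[OF X] H_Nil[OF Y] H_Nil[OF Z] by blast+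
    show ?case
      unfolding plus_fun_apply fscl_apply hom_bracket_Nil hom_bracket_single[OF Y Z H_Nil[OF X]]
        hom_bracket_single[OF X Y H_Nil[OF Z]] hom_bracket_single[OF X Z H_Nil[OF Y]] swaps
        W[THEN W_diff_arg] W[THEN W_Cons_scale]
      by (cases p; cases q; cases r; simp add: algebra_simps)
  next
    case (Cons a vs s ps)
    note a = Cons.hyps(1) and X = Cons.prems(1) and Y = Cons.prems(2) and Z = Cons.prems(3)
    note W = X[THEN H_W] Y[THEN H_W] Z[THEN H_W]
    note IH1 = Cons.IH[OF X Y H_contract[OF Z a]]
      and IH2 = Cons.IH[OF X H_contract[OF Y a] Z]
      and IH3 = Cons.IH[OF H_contract[OF X a] Y Z]
    note simps = hom_bracket_Cons[OF _ _ a] contract_hom_bracket[OF _ _ a] W hom_bracket_W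
        contract_W W_scale
      hom_bracket_add_left hom_bracket_add_right hom_bracket_scale_left hom_bracket_scale_right
    have 1: "hom_bracket p (q + r) X (hom_bracket q r Y Z) (a # vs) =
        hom_bracket p (q + (r + s)) X (hom_bracket q (r + s) Y (contract a Z)) vs +
        scl (psign (s * r)) (hom_bracket p (q + s + r) X (hom_bracket (q + s) r (contract a Y) Z) vs) +
        scl (psign (s * (q + r))) (hom_bracket (p + s) (q + r) (contract a X) (hom_bracket q r Y Z) vs)"
      by (simp add: simps) (simp add: add_ac)
    have 2: "hom_bracket (p + q) r (hom_bracket p q X Y) Z (a # vs) =
        hom_bracket (p + q) (r + s) (hom_bracket p q X Y) (contract a Z) vs +
        scl (psign (s * r)) (hom_bracket (p + (q + s)) r (hom_bracket p (q + s) X (contract a Y)) Z vs +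
          scl (psign (s * q)) (hom_bracket (p + s + q) r (hom_bracket (p + s) q (contract a X) Y) Z vs))"
      by (simp add: simps) (simp add: add_ac)
    have 3: "hom_bracket q (p + r) Y (hom_bracket p r X Z) (a # vs) =
        hom_bracket q (p + (r + s)) Y (hom_bracket p (r + s) X (contract a Z)) vs +
        scl (psign (s * r)) (hom_bracket q (p + s + r) Y (hom_bracket (p + s) r (contract a X) Z) vs) +
        scl (psign (s * (p + r))) (hom_bracket (q + s) (p + r) (contract a Y) (hom_bracket p r X Z) vs)"
      by (simp add: simps) (simp add: add_ac)
    show ?case
      unfolding plus_fun_apply fscl_apply 1 2 3 IH1 IH2 IH3
      by (cases p; cases q; cases r; cases s; simp add: algebra_simps)
  qed
qed (use assms in \<open>simp_all add: hom_bracket_W H_W W_add W_scale\<close>)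

section \<open>The derivation condition and the Leibniz rule\<close>

definition deriv :: "('a list \<Rightarrow> 'a) \<Rightarrow> bool" where
  "deriv X \<longleftrightarrow> (\<forall>us p q. \<forall>a\<in>A p. \<forall>b\<in>A q. X (us @ [mul a b]) =
     mul (X (us @ [a])) b + scl (psign (p * q)) (mul (X (us @ [b])) a))"

lemma derivD: "deriv X \<Longrightarrow> a \<in> A p \<Longrightarrow> b \<in> A q \<Longrightarrow> X (us @ [mul a b]) =
     mul (X (us @ [a])) b + scl (psign (p * q)) (mul (X (us @ [b])) a)"
  unfolding deriv_def by blast

lemma derivD1: "deriv X \<Longrightarrow> a \<in> A p \<Longrightarrow> b \<in> A q \<Longrightarrow> X [mul a b] =
     mul (X [a]) b + scl (psign (p * q)) (mul (X [b]) a)"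
  and derivD2: "deriv X \<Longrightarrow> a \<in> A p \<Longrightarrow> b \<in> A q \<Longrightarrow> X [c, mul a b] =
     mul (X [c, a]) b + scl (psign (p * q)) (mul (X [c, b]) a)"
  using derivD[of X a p b q "[]"] derivD[of X a p b q "[c]"] by simp_all

text \<open>The reason for stating \<open>deriv\<close> in the last argument: contractions consume
  the arguments in front of it.\<close>

lemma deriv_contract: "deriv X \<Longrightarrow> deriv (contract c X)"
  using derivD[of X _ _ _ _ "c # _"] by (simp add: deriv_def contract_def)

text \<open>As in \<open>W_ext\<close>, the arguments in front are split into parity components one
  at a time.\<close>

lemma derivI:
  assumes X: "X \<in> W'"
    and hom: "\<And>us ps p q a b. list_all2 (\<lambda>v q. v \<in> A q) us ps \<Longrightarrow> a \<in> A p \<Longrightarrow> b \<in> A q \<Longrightarrow>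
      X (us @ [mul a b]) = mul (X (us @ [a])) b + scl (psign (p * q)) (mul (X (us @ [b])) a)"
  shows "deriv X"
  unfolding deriv_def
proof (intro allI ballI)
  fix us p q a b assume ab: "a \<in> A p" "b \<in> A q"
  have "X (ws @ us @ [mul a b]) = mul (X (ws @ us @ [a])) b +
      scl (psign (p * q)) (mul (X (ws @ us @ [b])) a)"
    if "list_all2 (\<lambda>v q. v \<in> A q) ws ps" for ws ps
    using that
  proof (induction us arbitrary: ws ps)
    case Nil
    then show ?case using hom ab by simp
  next
    case (Cons u us)
    have "X ((ws @ [part A r u]) @ us @ [mul a b]) = mul (X ((ws @ [part A r u]) @ us @ [a])) b +
        scl (psign (p * q)) (mul (X ((ws @ [part A r u]) @ us @ [b])) a)" for r
      using Cons.prems A.part_mem[of u r]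
      by (intro Cons.IH[of _ "ps @ [r]"]) (simp add: list_all2_appendI)
    then show ?case
      using W_split[OF X, of ws u] by (simp add: mul_add_left A.scale_right_distrib add_ac)
  qed
  from this[of "[]" "[]"]
  show "X (us @ [mul a b]) = mul (X (us @ [a])) b + scl (psign (p * q)) (mul (X (us @ [b])) a)" by simp
qed

lemma hom_concat_deriv:
  assumes "X \<in> W'" "Y \<in> H q" "deriv X" "deriv Y"
  shows "deriv (hom_concat q X Y)"
proof (rule derivI)
  fix us ps t u a b
  assume us: "list_all2 (\<lambda>v q. v \<in> A q) us ps" and a: "a \<in> A t" and b: "b \<in> A u"
  from us assms show "hom_concat q X Y (us @ [mul a b]) =
      mul (hom_concat q X Y (us @ [a])) b + scl (psign (t * u)) (mul (hom_concat q X Y (us @ [b])) a)"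
  proof (induction arbitrary: q X Y rule: list_all2_induct)
    case Nil
    note X = Nil(1) and Y = Nil(2)
    have single: "hom_concat q X Y [c] = mul (X []) (Y [c]) + scl (psign (v * q)) (mul (X [c]) (Y []))"
      if "c \<in> A v" for c v
      using C.shuffle_prod_Cons[OF X H_W[OF Y] that, of q "[]"] by (simp add: contract_def del:
          C.shuffle_prod.simps(2))
    \<comment> \<open>After the derivation rule for X, the two sides differ only in the order of
      \<open>Y []\<close> and \<open>a\<close> or \<open>b\<close>.\<close>
    note comm = mul_comm[OF H_Nil[OF Y] a] mul_comm[OF H_Nil[OF Y] b]
    show ?case
      unfolding append_Nil single[OF mul_mem[OF a b]] single[OF a] single[OF b]
        derivD1[OF Nil(3) a b] derivD1[OF Nil(4) a b]
        mul_add_left mul_add_right mul_scale_left mul_scale_right mul_assoc comm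
      by (cases q; cases t; cases u; simp add: algebra_simps del: C.shuffle_prod.simps(2))
  next
    case (Cons c vs s ps)
    note c = Cons.hyps(1) and X = Cons.prems(1) and Y = Cons.prems(2)
    note IH = Cons.IH[OF X H_contract[OF Y c] Cons.prems(3) deriv_contract[OF Cons.prems(4)]]
      Cons.IH[OF contract_W[OF X] Y deriv_contract[OF Cons.prems(3)] Cons.prems(4), of c]
    show ?case
      unfolding append_Cons C.shuffle_prod_Cons[OF X H_W[OF Y] c] IH
      by (simp add: mul_add_left mul_scale_left A.scale_right_distrib mult_ac add_ac del:
          C.shuffle_prod.simps(2))
  qed
qed (use assms in \<open>simp_all add: C.shuffle_prod_W H_W\<close>)

text \<open>At one argument this is the closure of derivations under the commutator, together with
  terms such as \<open>X [Y [], c]\<close>, which are derivations in \<open>c\<close> by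
  hypothesis.\<close>

lemma hom_bracket_deriv:
  assumes "X \<in> H p" "Y \<in> H q" "deriv X" "deriv Y"
  shows "deriv (hom_bracket p q X Y)"
proof (rule derivI)
  fix us ps t u a b
  assume us: "list_all2 (\<lambda>v q. v \<in> A q) us ps" and a: "a \<in> A t" and b: "b \<in> A u"
  from us assms show "hom_bracket p q X Y (us @ [mul a b]) =
      mul (hom_bracket p q X Y (us @ [a])) b +
          scl (psign (t * u)) (mul (hom_bracket p q X Y (us @ [b])) a)"
  proof (induction arbitrary: p q X Y rule: list_all2_induct)
    case Nil
    note X = Nil(1) and Y = Nil(2) and dX = Nil(3) and dY = Nil(4)
    note W = X[THEN H_W] Y[THEN H_W]
    note mem = H_single[OF X a] H_single[OF X b] H_single[OF Y a] H_single[OF Y b]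
    \<comment> \<open>The cross terms, products of a value of X and a value of Y, cancel once they
      are written in the same order.\<close>
    note comm = mul_comm[OF mem(1) mem(4)] mul_comm[OF mem(2) mem(3)]
    show ?case
      unfolding append_Nil hom_bracket_single[OF X Y mul_mem[OF a b]] hom_bracket_single[OF X Y a]
          hom_bracket_single[OF X Y b]
        derivD1[OF dX a b] derivD1[OF dY a b] derivD2[OF dX a b] derivD2[OF dY a b]
        W[THEN W_Cons_add] W[THEN W_Cons_scale]
        derivD1[OF dX mem(3) b] derivD1[OF dX mem(4) a] derivD1[OF dY mem(1) b] derivD1[OF dY mem(2) a]
        comm
      by (cases p; cases q; cases t; cases u;
          simp add: algebra_simps mul_add_left mul_add_right mul_scale_left mul_scale_right
              mul_minus_left mul_diff_left)
  next
    case (Cons c vs s ps)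
    note c = Cons.hyps(1) and X = Cons.prems(1) and Y = Cons.prems(2)
    note IH = Cons.IH[OF X H_contract[OF Y c] Cons.prems(3) deriv_contract[OF Cons.prems(4)]]
      Cons.IH[OF H_contract[OF X c] Y deriv_contract[OF Cons.prems(3)] Cons.prems(4)]
    show ?case
      unfolding append_Cons hom_bracket_Cons[OF X[THEN H_W] Y[THEN H_W] c] IH
      by (simp add: mul_add_left mul_scale_left A.scale_right_distrib mult_ac add_ac)
  qed
qed (use assms in \<open>simp_all add: hom_bracket_W H_W\<close>)

text \<open>The derivation condition enters at the empty list, where X is applied to the product of
  \<open>Y []\<close> and \<open>Z []\<close>; the contraction rule for concatenation accounts for
  the other half of the bracket.\<close>

lemma hom_bracket_leibniz:
  assumes "X \<in> H p" "Y \<in> H q" "Z \<in> H r" "deriv X"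
  shows "hom_bracket p (q + r) X (hom_concat r Y Z) =
    hom_concat r (hom_bracket p q X Y) Z +
      fscl scl (psign (p * q)) (hom_concat (p + r) Y (hom_bracket p r X Z))"
proof (rule W_ext)
  fix ps vs assume "list_all2 (\<lambda>v q. v \<in> A q) vs ps"
  then show "hom_bracket p (q + r) X (hom_concat r Y Z) vs =
    (hom_concat r (hom_bracket p q X Y) Z +
      fscl scl (psign (p * q)) (hom_concat (p + r) Y (hom_bracket p r X Z))) vs"
    using assms
  proof (induction arbitrary: p q r X Y Z rule: list_all2_induct)
    case Nil
    note X = Nil(1) and Y = Nil(2) and Z = Nil(3) and dX = Nil(4)
    note W = X[THEN H_W] Y[THEN H_W] Z[THEN H_W]
    have cp1: "hom_concat r Y Z [X []] = mul (Y []) (Z [X []]) +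
        scl (psign (p * r)) (mul (Y [X []]) (Z []))"
      using C.shuffle_prod_Cons[OF W(2,3) H_Nil[OF X], of r "[]"] by (simp add: contract_def del:
          C.shuffle_prod.simps(2))
    have cp2: "hom_concat r Y Z [] = mul (Y []) (Z [])" for r Y Z by simp
    note comm = mul_comm[OF H_single[OF X H_Nil[OF Z]] H_Nil[OF Y]]
    show ?case
      unfolding plus_fun_apply fscl_apply hom_bracket_Nil cp1 cp2 derivD1[OF dX H_Nil[OF Y]
          H_Nil[OF Z]] comm
      by (cases p; cases q; cases r;
        simp add: algebra_simps mul_add_left mul_add_right mul_minus_left mul_minus_right
          mul_diff_left mul_diff_right del: C.shuffle_prod.simps(2))
  next
    case (Cons a vs s ps)
    note a = Cons.hyps(1) and X = Cons.prems(1) and Y = Cons.prems(2) and Z = Cons.prems(3)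
      and dX = Cons.prems(4)
    note W = X[THEN H_W] Y[THEN H_W] Z[THEN H_W]
    note IH1 = Cons.IH[OF X Y H_contract[OF Z a] dX]
      and IH2 = Cons.IH[OF X H_contract[OF Y a] Z dX]
      and IH3 = Cons.IH[OF H_contract[OF X a] Y Z deriv_contract[OF dX]]
    note simps = hom_bracket_Cons[OF _ _ a] contract_hom_bracket[OF _ _ a] C.shuffle_prod_Cons[OF
        _ _ a] C.contract_shuffle_prod[OF _ _ a]
      W hom_bracket_W C.shuffle_prod_W contract_W W_scale hom_bracket_add_right hom_bracket_scale_right
      C.shuffle_prod_add_left C.shuffle_prod_add_right C.shuffle_prod_scale_left
          C.shuffle_prod_scale_right
    have 1: "hom_bracket p (q + r) X (hom_concat r Y Z) (a # vs) =
        hom_bracket p (q + (r + s)) X (hom_concat (r + s) Y (contract a Z)) vs +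
        scl (psign (s * r)) (hom_bracket p (q + s + r) X (hom_concat r (contract a Y) Z) vs) +
        scl (psign (s * (q + r))) (hom_bracket (p + s) (q + r) (contract a X) (hom_concat r Y Z) vs)"
      by (simp add: simps del: C.shuffle_prod.simps(2)) (simp add: add_ac)
    have 2: "hom_concat r (hom_bracket p q X Y) Z (a # vs) =
        hom_concat (r + s) (hom_bracket p q X Y) (contract a Z) vs +
        scl (psign (s * r)) (hom_concat r (hom_bracket p (q + s) X (contract a Y)) Z vs +
          scl (psign (s * q)) (hom_concat r (hom_bracket (p + s) q (contract a X) Y) Z vs))"
      by (simp add: simps del: C.shuffle_prod.simps(2))
    have 3: "hom_concat (p + r) Y (hom_bracket p r X Z) (a # vs) =
        hom_concat (p + (r + s)) Y (hom_bracket p (r + s) X (contract a Z)) vs +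
        scl (psign (s * r)) (hom_concat (p + s + r) Y (hom_bracket (p + s) r (contract a X) Z) vs) +
        scl (psign (s * (p + r))) (hom_concat (p + r) (contract a Y) (hom_bracket p r X Z) vs)"
      by (simp add: simps del: C.shuffle_prod.simps(2)) (simp add: add_ac)
    show ?case
      unfolding plus_fun_apply fscl_apply 1 2 3 IH1 IH2 IH3
      by (cases p; cases q; cases r; cases s; simp add: algebra_simps del: C.shuffle_prod.simps(2))
  qed
qed (use assms in \<open>simp_all add: hom_bracket_W C.shuffle_prod_W H_W W_add W_scale\<close>)

end

section \<open>Parity decomposition and the prolongation\<close>

context super_comm_assoc
begin

text \<open>The grading involution of A, whose eigenspaces are the even and the odd part.\<close>

definition parity_inv :: "'a \<Rightarrow> 'a" where
  "parity_inv a = part A 0 a - part A 1 a"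

text \<open>Conjugation by the grading involution; on \<open>H p\<close> it is multiplication by
  \<open>psign p\<close>.\<close>

definition parity_inv_cochain :: "('a list \<Rightarrow> 'a) \<Rightarrow> 'a list \<Rightarrow> 'a" where
  "parity_inv_cochain X vs = parity_inv (X (map parity_inv vs))"

lemma parity_inv_add: "parity_inv (a + b) = parity_inv a + parity_inv b"
  and parity_inv_scale: "parity_inv (scl c a) = scl c (parity_inv a)"
  by (simp_all add: parity_inv_def A.part_add A.part_scale A.scale_right_diff_distrib)

lemma parity_inv_0 [simp]: "parity_inv 0 = 0"
  using parity_inv_scale[of 0 0] by simp

lemma parity_inv_hom: "a \<in> A p \<Longrightarrow> parity_inv a = scl (psign p) a"
  by (cases p) (simp_all add: parity_inv_def A.part_cases)

lemma parity_inv_parity_inv [simp]: "parity_inv (parity_inv a) = a"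
proof -
  have "parity_inv (parity_inv (part A p a)) = part A p a" for p
    using A.part_mem[of a p] by (simp add: parity_inv_hom parity_inv_scale)
  then have "parity_inv (parity_inv (part A 0 a + part A 1 a)) = part A 0 a + part A 1 a"
    by (simp only: parity_inv_add)
  then show ?thesis by (simp add: A.part_sum)
qed

text \<open>Parities add under multiplication, so the involution is an algebra automorphism; this is
  what makes conjugation respect \<open>deriv\<close>.\<close>

lemma parity_inv_mul: "parity_inv (mul a b) = mul (parity_inv a) (parity_inv b)"
proof -
  have "parity_inv (mul (part A p a) (part A q b)) =
      mul (parity_inv (part A p a)) (parity_inv (part A q b))" for p q
    using A.part_mem[of a p] A.part_mem[of b q]
    by (simp add: parity_inv_hom[OF mul_mem] parity_inv_hom mul_scale_left mul_scale_right
        psign_add mult.commute)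
  then have "parity_inv (mul (part A 0 a + part A 1 a) (part A 0 b + part A 1 b)) =
      mul (parity_inv (part A 0 a + part A 1 a)) (parity_inv (part A 0 b + part A 1 b))"
    by (simp add: mul_add_left mul_add_right parity_inv_add)
  then show ?thesis by (simp add: A.part_sum)
qed

lemma parity_inv_list:
  assumes "X \<in> W'" "list_all2 (\<lambda>v q. v \<in> A q) vs ps"
  shows "X (map parity_inv vs) = scl (psign (sum_list ps)) (X vs)"
  using assms(2,1)
proof (induction arbitrary: X rule: list_all2_induct)
  case (Cons a vs p ps)
  then show ?case
    using Cons.IH[OF contract_W, of X a]
    by (simp add: parity_inv_hom W_Cons_scale contract_def psign_add)
qed simp

lemma parity_inv_cochain_W:
  assumes X: "X \<in> W'"
  shows "parity_inv_cochain X \<in> W'"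
proof -
  obtain n where "vanish n X" using X by (auto simp: W_iff)
  then have "vanish n (parity_inv_cochain X)" by (simp add: vanish_def parity_inv_cochain_def)
  moreover have "parity_inv_cochain X \<in> smultilinear"
  proof (rule smultilinearI)
    fix p q a b us vs assume "a \<in> A p" "b \<in> A q"
    then show "parity_inv_cochain X (us @ a # b # vs) =
        scl (psign (p * q)) (parity_inv_cochain X (us @ b # a # vs))"
      using W_swap[OF X, of a p b q "map parity_inv us" "map parity_inv vs"]
        W_lin_scale[OF X, of "map parity_inv us @ [_]"] W_lin_scale[OF X, of "map parity_inv us"]
      by (simp add: parity_inv_cochain_def parity_inv_hom parity_inv_scale mult_ac)
  qed (simp_all add: parity_inv_cochain_def parity_inv_add parity_inv_scale W_lin_add[OF X]
      W_lin_scale[OF X])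
  ultimately show ?thesis by (auto simp: W_iff)
qed

lemma parity_inv_cochain_deriv:
  assumes "X \<in> W'" "deriv X"
  shows "deriv (parity_inv_cochain X)"
  unfolding deriv_def
proof (intro allI ballI)
  fix us p q a b assume a: "a \<in> A p" and b: "b \<in> A q"
  have "X (map parity_inv us @ [mul (parity_inv a) (parity_inv b)]) =
      mul (X (map parity_inv us @ [parity_inv a])) (parity_inv b) +
          scl (psign (p * q)) (mul (X (map parity_inv us @ [parity_inv b])) (parity_inv a))"
    using a b by (intro derivD assms(2)) (simp_all add: parity_inv_hom A.subspace_scale A.subspace_part)
  then show "parity_inv_cochain X (us @ [mul a b]) =
      mul (parity_inv_cochain X (us @ [a])) b +
          scl (psign (p * q)) (mul (parity_inv_cochain X (us @ [b])) a)"
    by (simp add: parity_inv_cochain_def parity_inv_mul parity_inv_add parity_inv_scale)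
qed


text \<open>The projection to the eigenspace of conjugation with eigenvalue
  \<open>psign p\<close>.\<close>

definition parity_proj :: "bit \<Rightarrow> ('a list \<Rightarrow> 'a) \<Rightarrow> 'a list \<Rightarrow> 'a" where
  "parity_proj p X = fscl scl (1/2) (X + fscl scl (psign p) (parity_inv_cochain X))"

lemma half_double: "scl (1/2) (a + a) = a"
  unfolding A.scale_right_distrib A.scale_left_distrib[symmetric] by simp

lemma parity_proj_sum: "parity_proj 0 X + parity_proj 1 X = X"
proof
  fix vs
  have "scl (1/2) (x + y) + scl (1/2) (x - y) = x" for x y
    unfolding A.scale_right_distrib[symmetric] by (simp add: half_double)
  then show "(parity_proj 0 X + parity_proj 1 X) vs = X vs" by (simp add: parity_proj_def)
qed

lemma half_part: "scl (1/2) (a + scl (psign p) (parity_inv a)) = part A p a"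
proof -
  have "a + scl (psign p) (parity_inv a) = (part A 0 a + part A 1 a) +
      scl (psign p) (part A 0 a - part A 1 a)"
    by (simp add: parity_inv_def A.part_sum)
  also have "\<dots> = part A p a + part A p a"
    by (cases p) simp_all
  finally show ?thesis by (simp only: half_double)
qed

lemma parity_proj_H:
  assumes X: "X \<in> W'"
  shows "parity_proj p X \<in> H p"
  unfolding H_iff
proof (intro conjI allI impI)
  show "parity_proj p X \<in> W'"
    unfolding parity_proj_def using X by (intro W_scale W_add parity_inv_cochain_W)
  fix ps vs assume "list_all2 (\<lambda>v q. v \<in> A q) vs ps"
  then have "parity_proj p X vs = part A (p + sum_list ps) (X vs)"
    by (simp add: parity_proj_def parity_inv_cochain_def parity_inv_list[OF X] parity_inv_scale
        half_part[symmetric] psign_add)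
  then show "parity_proj p X vs \<in> A (p + sum_list ps)" by (simp add: A.part_mem)
qed

text \<open>A subspace stable under conjugation contains the images of its elements under both
  projections. One stability check thus yields the parity decompositions of W, of the prolongation
  and of each of its degrees.\<close>

lemma superspace_H:
  assumes sub: "F.subspace S" "S \<subseteq> W'" and inv: "\<And>X. X \<in> S \<Longrightarrow> parity_inv_cochain X \<in> S"
  shows "superspace (fscl scl) S (\<lambda>p. H p \<inter> S)"
proof (rule superspaceI)
  show "vector_space (fscl scl)" by (rule F.vector_space_axioms)
  show "F.subspace (H p \<inter> S)" for p
    by (intro F.subspace_inter sub(1)) (intro F.subspaceI H_0 H_add H_scale)
  show "X \<in> S \<longleftrightarrow> (\<exists>Y\<in>H 0 \<inter> S. \<exists>Z\<in>H 1 \<inter> S. X = Y + Z)" for X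
  proof
    assume X: "X \<in> S"
    have "parity_proj p X \<in> S" for p
      unfolding parity_proj_def by (intro F.subspace_scale[OF sub(1)] F.subspace_add[OF sub(1)] X inv)
    moreover have "parity_proj p X \<in> H p" for p
      using X sub(2) by (intro parity_proj_H) blast
    ultimately have "parity_proj p X \<in> H p \<inter> S" for p by simp
    then show "\<exists>Y\<in>H 0 \<inter> S. \<exists>Z\<in>H 1 \<inter> S. X = Y + Z"
      using parity_proj_sum[of X] by metis
  qed (use F.subspace_add[OF sub(1)] in blast)
  fix X assume X: "X \<in> H 0 \<inter> S" "X \<in> H 1 \<inter> S"
  show "X = 0"
  proof (rule W_ext)
    fix ps vs assume "list_all2 (\<lambda>v q. v \<in> A q) vs ps"
    then have "X vs \<in> A (sum_list ps)" "X vs \<in> A (sum_list ps + 1)"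
      using X H_mem[of X 0 vs ps] H_mem[of X 1 vs ps] by (auto simp: add.commute)
    then show "X vs = 0 vs" using A.parts_disjoint by simp
  qed (use X sub(2) W_0 in auto)
qed

lemma W_subspace: "F.subspace W'"
  by (intro F.subspaceI W_0 W_add W_scale)

lemma superspace_W: "superspace (fscl scl) W' H"
proof -
  have "H p \<inter> W' = H p" for p by (auto simp: H_iff)
  then show ?thesis
    using superspace_H[OF W_subspace] parity_inv_cochain_W by simp
qed

end

sublocale super_comm_assoc \<subseteq> W: super_space "fscl scl" W' H
  by (simp add: super_space_def super_space_axioms_def superspace_W F.vector_space_axioms)

context super_comm_assoc
begin

text \<open>A description of the prolongation without degrees; see
  \<open>P_space_eq\<close>.\<close>

abbreviation D where "D \<equiv> {X \<in> W'. deriv X}"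

lemma deriv_0: "deriv 0" and deriv_add: "deriv X \<Longrightarrow> deriv Y \<Longrightarrow> deriv (X + Y)"
  and deriv_scale: "deriv X \<Longrightarrow> deriv (fscl scl c X)"
  unfolding deriv_def
  by (simp_all add: mul_add_left mul_scale_left A.scale_right_distrib add_ac mult_ac)

lemma D_subspace: "F.subspace D"
  by (intro F.subspaceI) (auto intro: W_0 W_add W_scale deriv_0 deriv_add deriv_scale)

lemma superspace_D: "superspace (fscl scl) D (\<lambda>p. H p \<inter> D)"
  by (rule superspace_H[OF D_subspace]) (auto intro: parity_inv_cochain_W parity_inv_cochain_deriv)

text \<open>A decomposition inside S is also one inside W, where it is unique.\<close>

lemma part_subspace:
  assumes "superspace (fscl scl) S (\<lambda>p. H p \<inter> S)" "X \<in> S"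
  shows "part H p X \<in> S"
proof -
  interpret S: super_space "fscl scl" S "\<lambda>p. H p \<inter> S"
    by (simp add: super_space_def super_space_axioms_def assms(1) F.vector_space_axioms)
  have "part H p X = part (\<lambda>p. H p \<inter> S) p X"
    using S.part_mem_and_diff[OF assms(2), of p] by (intro W.part_unique) auto
  then show ?thesis using S.part_mem[OF assms(2), of p] by simp
qed

section \<open>The operations on inhomogeneous cochains\<close>

lemma concat_prod_eq: "concat_prod scl A mul X Y =
    hom_concat 0 X (part H 0 Y) + hom_concat 1 X (part H 1 Y)"
proof -
  have "hom_concat q X Y = hom_ext A (shuffle_sum scl q (\<lambda>us ws. mul (X us) (Y ws)))" for q X Y
    by (simp add: fun_eq_iff hom_ext_shuffle_sum_mul)
  then show ?thesis
    by (simp add: concat_prod_def Let_def shuffle_sum_def[abs_def])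
qed

lemma concat_prod_hom: "X \<in> W' \<Longrightarrow> Y \<in> H q \<Longrightarrow> concat_prod scl A mul X Y = hom_concat q X Y"
  by (cases q) (simp_all add: concat_prod_eq W.part_cases C.shuffle_prod_0_right)

lemma W_bracket_eq:
  assumes "X \<in> W'" "Y \<in> W'"
  shows "W_bracket scl A X Y = (\<Sum>p\<in>{0, 1}. \<Sum>q\<in>{0, 1}. hom_bracket p q (part H p X) (part H q Y))"
  unfolding W_bracket_def hom_bracket_def Let_def
  using W.part_mem[OF assms(1)] W.part_mem[OF assms(2)]
  by (intro sum.cong refl arg_cong2[where f = "(-)"]
      arg_cong[where f = "fscl scl _"] ext box_eq_shuffle_prod)
    (auto intro: H_W)

lemma W_bracket_hom: "X \<in> H p \<Longrightarrow> Y \<in> H q \<Longrightarrow> W_bracket scl A X Y = hom_bracket p q X Y"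
  by (cases p; cases q)
    (simp_all add: W_bracket_eq H_W W.part_cases hom_bracket_0_left hom_bracket_0_right W_0)

lemma part_W: "X \<in> W' \<Longrightarrow> part H p X \<in> W'"
  using W.part_mem H_W by blast

lemma concat_W: "X \<in> W' \<Longrightarrow> Y \<in> W' \<Longrightarrow> concat_prod scl A mul X Y \<in> W'"
  by (simp add: concat_prod_eq W_add C.shuffle_prod_W part_W)

lemma concat_add_left: "X \<in> W' \<Longrightarrow> X' \<in> W' \<Longrightarrow> Y \<in> W' \<Longrightarrow>
    concat_prod scl A mul (X + X') Y = concat_prod scl A mul X Y + concat_prod scl A mul X' Y"
  and concat_add_right: "X \<in> W' \<Longrightarrow> Y \<in> W' \<Longrightarrow> Y' \<in> W' \<Longrightarrow>
    concat_prod scl A mul X (Y + Y') = concat_prod scl A mul X Y + concat_prod scl A mul X Y'"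
  and concat_scale_left: "X \<in> W' \<Longrightarrow> Y \<in> W' \<Longrightarrow>
    concat_prod scl A mul (fscl scl c X) Y = fscl scl c (concat_prod scl A mul X Y)"
  and concat_scale_right: "X \<in> W' \<Longrightarrow> Y \<in> W' \<Longrightarrow>
    concat_prod scl A mul X (fscl scl c Y) = fscl scl c (concat_prod scl A mul X Y)"
  by (simp_all add: concat_prod_eq C.shuffle_prod_add_left C.shuffle_prod_add_right
      C.shuffle_prod_scale_left C.shuffle_prod_scale_right part_W
      W.part_add W.part_scale fscl_distrib add_ac)

lemma W_bracket_add_left: "X \<in> W' \<Longrightarrow> X' \<in> W' \<Longrightarrow> Y \<in> W' \<Longrightarrow>
    W_bracket scl A (X + X') Y = W_bracket scl A X Y + W_bracket scl A X' Y"
  and W_bracket_add_right: "X \<in> W' \<Longrightarrow> Y \<in> W' \<Longrightarrow> Y' \<in> W' \<Longrightarrow>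
    W_bracket scl A X (Y + Y') = W_bracket scl A X Y + W_bracket scl A X Y'"
  and W_bracket_scale_left: "X \<in> W' \<Longrightarrow> Y \<in> W' \<Longrightarrow>
    W_bracket scl A (fscl scl c X) Y = fscl scl c (W_bracket scl A X Y)"
  and W_bracket_scale_right: "X \<in> W' \<Longrightarrow> Y \<in> W' \<Longrightarrow>
    W_bracket scl A X (fscl scl c Y) = fscl scl c (W_bracket scl A X Y)"
  by (simp_all add: W_bracket_eq W_add W_scale hom_bracket_add_left hom_bracket_add_right
      hom_bracket_scale_left hom_bracket_scale_right part_W
      W.part_add W.part_scale fscl_distrib add_ac)

lemma part_D: "X \<in> D \<Longrightarrow> part H p X \<in> H p \<inter> D"
  using part_subspace[OF superspace_D] W.part_mem[of X p] by auto

lemma concat_D: "X \<in> D \<Longrightarrow> Y \<in> D \<Longrightarrow> concat_prod scl A mul X Y \<in> D"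
  using part_D[of Y] by (auto simp: concat_prod_eq intro!: W_add C.shuffle_prod_W deriv_add
      hom_concat_deriv)

lemma W_bracket_D: "X \<in> D \<Longrightarrow> Y \<in> D \<Longrightarrow> W_bracket scl A X Y \<in> D"
  using part_D[of X] part_D[of Y]
  by (auto simp: W_bracket_eq intro!: W_add hom_bracket_W deriv_add hom_bracket_deriv)

text \<open>Associativity is demanded of all elements, not only of homogeneous ones; bilinearity
  reduces it to the parity components of Y and Z.\<close>

lemma concat_assoc:
  assumes X: "X \<in> W'" and Y: "Y \<in> W'" and Z: "Z \<in> W'"
  shows "concat_prod scl A mul (concat_prod scl A mul X Y) Z =
    concat_prod scl A mul X (concat_prod scl A mul Y Z)"
proof -
  have "concat_prod scl A mul (concat_prod scl A mul X (part H q Y)) (part H r Z) =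
    concat_prod scl A mul X (concat_prod scl A mul (part H q Y) (part H r Z))" for q r
    using W.part_mem[OF Y, of q] W.part_mem[OF Z, of r]
    by (simp add: concat_prod_hom[where q = q] concat_prod_hom[where q =
        r] concat_prod_hom[OF _ C.shuffle_prod_H]
        X H_W C.shuffle_prod_W hom_concat_assoc)
  then have "concat_prod scl A mul (concat_prod scl A mul X (part H 0 Y +
      part H 1 Y)) (part H 0 Z + part H 1 Z) =
    concat_prod scl A mul X (concat_prod scl A mul (part H 0 Y + part H 1 Y) (part H 0 Z + part H 1 Z))"
    by (simp add: concat_add_left concat_add_right concat_W part_W X Y Z W_add)
  then show ?thesis by (simp add: W.part_sum Y Z)
qed

section \<open>Cochains with a fixed number of variables\<close>

definition arity :: "nat \<Rightarrow> ('a list \<Rightarrow> 'a) \<Rightarrow> bool" where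
  "arity n X \<longleftrightarrow> (\<forall>vs. length vs \<noteq> n \<longrightarrow> X vs = 0)"

lemma SHom_W: "X \<in> SHom scl A n \<longleftrightarrow> X \<in> W' \<and> arity n X"
proof -
  have "arity n X \<Longrightarrow> vanish (Suc n) X" by (auto simp: arity_def vanish_def)
  then show ?thesis by (auto simp: SHom_iff W_iff arity_def)
qed

lemma arity_contract: "arity (Suc n) X \<Longrightarrow> arity n (contract a X)"
  and arity_0_contract: "arity 0 X \<Longrightarrow> contract a X = 0"
  by (auto simp: arity_def contract_def fun_eq_iff)

text \<open>Each contraction lowers the arity of exactly one factor, and a factor of arity 0 is
  killed by it.\<close>

lemma hom_concat_arity:
  assumes "X \<in> W'" "Y \<in> W'" "arity h X" "arity k Y"
  shows "arity (h + k) (hom_concat q X Y)"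
proof -
  have "hom_concat q X Y vs = 0" if "length vs \<noteq> h + k" for vs
    using assms that
  proof (induction vs arbitrary: h k q X Y)
    case Nil
    then show ?case by (cases "h = 0") (auto simp: arity_def)
  next
    case (Cons a vs)
    have "hom_concat r (contract b X) Y vs = 0" for r b
    proof (cases h)
      case 0
      then show ?thesis using Cons.prems by (simp add: arity_0_contract C.shuffle_prod_0_left)
    next
      case (Suc h')
      then show ?thesis using Cons.prems by (intro Cons.IH[of _ _ h' k]) (auto simp:
          arity_contract contract_W)
    qed
    moreover have "hom_concat r X (contract b Y) vs = 0" for r b
    proof (cases k)
      case 0
      then show ?thesis using Cons.prems by (simp add: arity_0_contract C.shuffle_prod_0_right)
    next
      case (Suc k')
      then show ?thesis using Cons.prems by (intro Cons.IH[of _ _ h k']) (auto simp: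
          arity_contract contract_W)
    qed
    ultimately show ?case by simp
  qed
  then show ?thesis by (simp add: arity_def)
qed

lemma arity_subspace: "F.subspace {X. arity n X}"
  by (intro F.subspaceI) (simp_all add: arity_def)

section \<open>Constants, and the prolongation in terms of contractions\<close>

lemma const_elem_H:
  assumes "a \<in> A p"
  shows "const_elem a \<in> H p"
  unfolding H_iff W_iff
proof (intro conjI allI impI smultilinearI exI[of _ "Suc 0"])
  fix vs ps assume "list_all2 (\<lambda>v q. v \<in> A q) vs ps"
  then show "const_elem a vs \<in> A (p + sum_list ps)"
    using assms by (auto simp: const_elem_def A.subspace_0 A.subspace_part)
qed (auto simp: const_elem_def vanish_def)

lemma const_elem_W: "const_elem a \<in> W'"
proof -
  have "const_elem a = const_elem (part A 0 a) + const_elem (part A 1 a)"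
    by (auto simp: const_elem_def fun_eq_iff A.part_sum)
  then show ?thesis
    using H_W[OF const_elem_H[OF A.part_mem]] W_add by (metis UNIV_I)
qed

lemma part_const_elem: "part H q (const_elem a) = const_elem (part A q a)"
proof (rule W.part_unique)
  have "const_elem a - const_elem (part A q a) = const_elem (a - part A q a)"
    by (auto simp: const_elem_def fun_eq_iff)
  then show "const_elem a - const_elem (part A q a) \<in> H (q + 1)"
    using A.part_mem_and_diff[of a q] const_elem_H by simp
qed (simp add: const_elem_H A.part_mem)

lemma contract_const_elem: "contract b (const_elem a) = 0"
  by (simp add: contract_def const_elem_def fun_eq_iff)

text \<open>A constant has no slot for the value of X.\<close>

lemma hom_box_const_left: "X \<in> W' \<Longrightarrow> hom_box p (const_elem a) X = 0"
proof
  fix vs show "X \<in> W' \<Longrightarrow> hom_box p (const_elem a) X vs = 0 vs"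
  proof (induction vs arbitrary: p X)
    case Nil
    then show ?case by (simp add: const_elem_def)
  next
    case (Cons b vs)
    then show ?case by (simp add: contract_const_elem B.shuffle_prod_0_left contract_W)
  qed
qed

text \<open>Contractions of the constant vanish, so the recursion only contracts X by the given
  arguments, and \<open>a\<close> is inserted at the end; supersymmetry moves it to the
  front.\<close>

lemma hom_box_const_right:
  assumes "X \<in> W'" and a: "a \<in> A q"
  shows "hom_box q X (const_elem a) = contract a X"
proof (rule W_ext)
  fix ps vs assume "list_all2 (\<lambda>v q. v \<in> A q) vs ps"
  then show "hom_box q X (const_elem a) vs = contract a X vs"
    using assms(1)
  proof (induction arbitrary: X rule: list_all2_induct)
    case Nil
    then show ?case by (simp add: const_elem_def contract_def)
  next
    case (Cons c vs s ps)
    have "hom_box q X (const_elem a) (c # vs) = scl (psign (s * q)) (contract a (contract c X) vs)"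
      using Cons by (simp add: B.shuffle_prod_Cons[OF _ _ Cons.hyps(1)] const_elem_W contract_const_elem
          B.shuffle_prod_0_right contract_W del: B.shuffle_prod.simps(2))
    also have "\<dots> = contract a X (c # vs)"
      using contract_swap[OF Cons.prems a Cons.hyps(1)]
      by (simp add: contract_def fun_eq_iff mult.commute)
    finally show ?case .
  qed
qed (use assms in \<open>simp_all add: B.shuffle_prod_W const_elem_W contract_W\<close>)

text \<open>Turns the recursive condition in \<open>P_comp\<close>, a bracket with constants, into
  one on contractions.\<close>

lemma W_bracket_const:
  assumes "X \<in> W'"
  shows "W_bracket scl A X (const_elem a) = contract a X"
proof -
  have "hom_bracket p q (part H p X) (const_elem (part A q a)) =
      contract (part A q a) (part H p X)" for p q
    by (simp add: hom_bracket_def hom_box_const_right hom_box_const_left A.part_mem assms part_W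
        fun_eq_iff)
  then have "W_bracket scl A X (const_elem a) =
      contract (part A 0 a + part A 1 a) (part H 0 X + part H 1 X)"
    using assms
    by (simp add: W_bracket_eq const_elem_W part_const_elem contract_add part_W add_ac W_add)
  then show ?thesis using assms by (simp add: A.part_sum W.part_sum)
qed

text \<open>With at least two variables there is always an argument in front of the last one, by
  which to contract.\<close>

lemma deriv_contract_iff:
  assumes "arity (Suc (Suc n)) X"
  shows "deriv X \<longleftrightarrow> (\<forall>a. deriv (contract a X))"
proof
  assume *: "\<forall>a. deriv (contract a X)"
  show "deriv X"
    unfolding deriv_def
  proof (intro allI ballI)
    fix us p q a b assume ab: "a \<in> A p" "b \<in> A q"
    show "X (us @ [mul a b]) = mul (X (us @ [a])) b + scl (psign (p * q)) (mul (X (us @ [b])) a)"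
    proof (cases us)
      case Nil
      \<comment> \<open>Here all lists have length one, where X vanishes.\<close>
      then show ?thesis using assms by (simp add: arity_def)
    next
      case (Cons u us')
      then show ?thesis using derivD[OF *[rule_format, of u] ab, of us'] by (simp add: contract_def)
    qed
  qed
qed (simp add: deriv_contract)

text \<open>Each step of the prolongation asks for the derivation property of all contractions;
  \<open>deriv_contract_iff\<close> carries it up from \<open>Der\<close> in degree one.\<close>

lemma P_comp_iff: "X \<in> P_comp scl A mul k \<longleftrightarrow> X \<in> W' \<and> arity k X \<and> deriv X"
proof (induction k arbitrary: X)
  case 0
  \<comment> \<open>Every list in the derivation condition is nonempty, so both sides are
    zero.\<close>
  have "arity 0 X \<Longrightarrow> deriv X" by (simp add: arity_def deriv_def)
  then show ?case by (auto simp: SHom_W)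
next
  case (Suc k)
  show ?case
  proof (cases k)
    case 0
    have "deriv X \<longleftrightarrow> (\<lambda>a. X [a]) \<in> Der scl A mul" if "X \<in> SHom scl A 1"
    proof
      have "Vector_Spaces.linear scl scl (\<lambda>a. X ([] @ a # []))"
        using that unfolding SHom_def by blast
      then show "deriv X \<Longrightarrow> (\<lambda>a. X [a]) \<in> Der scl A mul"
        unfolding Der_def by (auto intro: derivD1)
      assume D: "(\<lambda>a. X [a]) \<in> Der scl A mul"
      show "deriv X"
        unfolding deriv_def
      proof (intro allI ballI)
        fix us p q a b assume ab: "a \<in> A p" "b \<in> A q"
        show "X (us @ [mul a b]) = mul (X (us @ [a])) b + scl (psign (p * q)) (mul (X (us @ [b])) a)"
        proof (cases us)
          case Nil
          have "\<forall>p q. \<forall>a\<in>A p. \<forall>b\<in>A q.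
              X [mul a b] = mul (X [a]) b + scl (psign (p * q)) (mul (X [b]) a)"
            using D by (simp add: Der_def)
          then show ?thesis using Nil ab by simp
        next
          case (Cons u us')
          then show ?thesis using that by (simp add: SHom_iff)
        qed
      qed
    qed
    then show ?thesis unfolding 0 by (auto simp: SHom_W)
  next
    case (Suc n)
    have "X \<in> P_comp scl A mul (Suc (Suc n)) \<longleftrightarrow>
        X \<in> W' \<and> arity (Suc (Suc n)) X \<and> (\<forall>a. W_bracket scl A X (const_elem a) \<in> P_comp scl A mul
            (Suc n))"
      by (simp add: SHom_W)
    also have "\<dots> \<longleftrightarrow> X \<in> W' \<and> arity (Suc (Suc n)) X \<and> deriv X"
      using Suc.IH[unfolded Suc] deriv_contract_iff[of n X]
      by (auto simp: W_bracket_const contract_W arity_contract)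
    finally show ?thesis unfolding Suc .
  qed
qed

lemma P_comp_subset: "P_comp scl A mul k \<subseteq> D"
  by (auto simp: P_comp_iff)

lemma P_comp_subspace: "F.subspace (P_comp scl A mul k)"
proof -
  have "P_comp scl A mul k = {X. arity k X} \<inter> D" by (auto simp: P_comp_iff)
  then show ?thesis using F.subspace_inter[OF arity_subspace D_subspace] by simp
qed

lemma P_space_eq: "P_space scl A mul = D"
proof
  show "P_space scl A mul \<subseteq> D"
  proof
    fix X assume "X \<in> P_space scl A mul"
    then obtain I x where X: "X = (\<Sum>i\<in>I. x i)" and x: "\<forall>i\<in>I. x i \<in> P_comp scl A mul i"
      by (auto simp: P_space_def sum_of_subspaces_def)
    show "X \<in> D"
      unfolding X using x P_comp_subset by (intro F.subspace_sum[OF D_subspace]) blast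
  qed
  show "D \<subseteq> P_space scl A mul"
  proof
    fix X assume X: "X \<in> D"
    then obtain n where n: "vanish n X" by (auto simp: W_iff)
    have "\<forall>i\<in>{..<n}. (\<lambda>vs. if length vs = i then X vs else 0) \<in> P_comp scl A mul i"
    proof
      fix i
      \<comment> \<open>The three lists in the derivation condition have the same length, so
        truncation keeps or kills all terms together.\<close>
      have "deriv (\<lambda>vs. if length vs = i then X vs else 0)"
        using X by (auto simp: deriv_def)
      then show "(\<lambda>vs. if length vs = i then X vs else 0) \<in> P_comp scl A mul i"
        using X smultilinear_length_part[of X i] by (auto simp: P_comp_iff SHom_W W_iff)
    qed
    then show "X \<in> P_space scl A mul"
      using vanish_sum[OF n] unfolding P_space_def sum_of_subspaces_def by blast
  qed
qed

lemma P_par_eq: "P_par scl A mul p = H p \<inter> D"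
  by (auto simp: P_par_def P_space_eq)

section \<open>Assembly of the graded Poisson structure\<close>

lemma parity_inv_cochain_arity: "arity k X \<Longrightarrow> arity k (parity_inv_cochain X)"
  by (simp add: arity_def parity_inv_cochain_def)

lemma superspace_P_comp: "superspace (fscl scl) (P_comp scl A mul k) (\<lambda>p. H p \<inter> P_comp scl A mul k)"
  using P_comp_subset
  by (intro superspace_H P_comp_subspace)
    (auto simp: P_comp_iff intro: parity_inv_cochain_W parity_inv_cochain_deriv parity_inv_cochain_arity)

text \<open>The product splits Y by parity, so the parity components of Y must stay in the same
  degree; \<open>superspace_P_comp\<close> provides this.\<close>

lemma concat_P_comp:
  assumes X: "X \<in> P_comp scl A mul h" and Y: "Y \<in> P_comp scl A mul k"
  shows "concat_prod scl A mul X Y \<in> P_comp scl A mul (h + k)"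
proof -
  have "part H q Y \<in> H q \<inter> P_comp scl A mul k" for q
    using part_subspace[OF superspace_P_comp Y] W.part_mem[of Y q] Y by (simp add: P_comp_iff)
  then have "hom_concat q X (part H q Y) \<in> P_comp scl A mul (h + k)" for q
    using X by (auto simp: P_comp_iff intro: C.shuffle_prod_W hom_concat_arity hom_concat_deriv)
  then show ?thesis
    unfolding concat_prod_eq by (intro F.subspace_add[OF P_comp_subspace])
qed

lemma P_graded: "graded_superspace (fscl scl) D (\<lambda>p. H p \<inter> D) (P_comp scl A mul)"
  unfolding graded_superspace_def internal_direct_sum_def
proof (intro conjI allI impI ballI)
  show "superspace (fscl scl) D (\<lambda>p. H p \<inter> D)" by (rule superspace_D)
  show "F.subspace (P_comp scl A mul k)" for k by (rule P_comp_subspace)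
  show "D = sum_of_subspaces (P_comp scl A mul)" by (simp add: P_space_eq[symmetric] P_space_def)
  have "H p \<inter> D \<inter> P_comp scl A mul k = H p \<inter> P_comp scl A mul k" for p k
    using P_comp_subset by blast
  then show "superspace (fscl scl) (P_comp scl A mul k) (\<lambda>p. H p \<inter> D \<inter> P_comp scl A mul k)" for k
    using superspace_P_comp by simp
next
  fix I x i assume "finite I" and x: "\<forall>i\<in>I. x i \<in> P_comp scl A mul i"
    and sum: "(\<Sum>i\<in>I. x i) = 0" and i: "i \<in> I"
  show "x i = 0"
  proof
    fix vs
    have app: "(\<Sum>i\<in>J. x i) vs = (\<Sum>i\<in>J. x i vs)" for J
      by (induction J rule: infinite_finite_induct) simp_all
    show "x i vs = 0 vs"
    proof (cases "length vs = i")
      case True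
      \<comment> \<open>On a list of length \<open>i\<close> only the component of degree
        \<open>i\<close> can be nonzero.\<close>
      have "(\<Sum>j\<in>I. x j vs) = (\<Sum>j\<in>{i}. x j vs)"
        using i x True \<open>finite I\<close> by (intro sum.mono_neutral_right) (auto simp: P_comp_iff arity_def)
      then show ?thesis using app[of I] sum by simp
    next
      case False
      then show ?thesis using x i by (simp add: P_comp_iff arity_def)
    qed
  qed
qed

lemma P_poisson:
  "poisson_superalgebra (fscl scl) D (\<lambda>p. H p \<inter> D) (concat_prod scl A mul) (W_bracket scl A)"
  unfolding poisson_superalgebra_def comm_assoc_superalgebra_def lie_superalgebra_def superalgebra_def
proof (intro conjI allI ballI)
  \<comment> \<open>The goal occurs twice, once for the product and once for the bracket.\<close>
  show "superspace (fscl scl) D (\<lambda>p. H p \<inter> D)" "superspace (fscl scl) D (\<lambda>p. H p \<inter> D)"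
    by (rule superspace_D)+
next
  fix X Y assume "X \<in> D" "Y \<in> D"
  then show "concat_prod scl A mul X Y \<in> D" "W_bracket scl A X Y \<in> D"
    by (rule concat_D W_bracket_D)+
next
  fix X Y Z assume "X \<in> D" "Y \<in> D" "Z \<in> D"
  then show "concat_prod scl A mul (X + Y) Z = concat_prod scl A mul X Z + concat_prod scl A mul Y Z"
    "concat_prod scl A mul X (Y + Z) = concat_prod scl A mul X Y + concat_prod scl A mul X Z"
    "W_bracket scl A (X + Y) Z = W_bracket scl A X Z + W_bracket scl A Y Z"
    "W_bracket scl A X (Y + Z) = W_bracket scl A X Y + W_bracket scl A X Z"
    "concat_prod scl A mul (concat_prod scl A mul X Y) Z =
      concat_prod scl A mul X (concat_prod scl A mul Y Z)"
    by (simp_all add: concat_add_left concat_add_right W_bracket_add_left W_bracket_add_right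
        concat_assoc)
next
  fix c X Y assume "X \<in> D" "Y \<in> D"
  then show "concat_prod scl A mul (fscl scl c X) Y = fscl scl c (concat_prod scl A mul X Y)"
    "concat_prod scl A mul X (fscl scl c Y) = fscl scl c (concat_prod scl A mul X Y)"
    "W_bracket scl A (fscl scl c X) Y = fscl scl c (W_bracket scl A X Y)"
    "W_bracket scl A X (fscl scl c Y) = fscl scl c (W_bracket scl A X Y)"
    by (simp_all add: concat_scale_left concat_scale_right W_bracket_scale_left W_bracket_scale_right)
next
  fix p q X Y assume X: "X \<in> H p \<inter> D" and Y: "Y \<in> H q \<inter> D"
  then have XY: "concat_prod scl A mul X Y = hom_concat q X Y"
      "W_bracket scl A X Y = hom_bracket p q X Y"
    "concat_prod scl A mul Y X = hom_concat p Y X" "W_bracket scl A Y X = hom_bracket q p Y X"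
    by (auto simp: concat_prod_hom W_bracket_hom)
  show "concat_prod scl A mul X Y \<in> H (p + q) \<inter> D" "W_bracket scl A X Y \<in> H (p + q) \<inter> D"
    using X Y concat_D[of X Y] W_bracket_D[of X Y] C.shuffle_prod_H hom_bracket_H by (auto simp: XY)
  show "concat_prod scl A mul X Y = fscl scl (psign (p * q)) (concat_prod scl A mul Y X)"
    using X Y hom_concat_comm by (simp add: XY)
  show "W_bracket scl A X Y = - fscl scl (psign (p * q)) (W_bracket scl A Y X)"
    unfolding XY by (rule hom_bracket_skew)
next
  fix p q r X Y Z assume "X \<in> H p \<inter> D" "Y \<in> H q \<inter> D" "Z \<in> H r \<inter> D"
  then have X: "X \<in> H p" "deriv X" and Y: "Y \<in> H q" and Z: "Z \<in> H r" by auto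
  note W = X(1)[THEN H_W] Y[THEN H_W] Z[THEN H_W]
  note YZ = hom_bracket_H[OF Y Z] and XY = hom_bracket_H[OF X(1) Y] and XZ = hom_bracket_H[OF X(1) Z]
  show "W_bracket scl A X (W_bracket scl A Y Z) = W_bracket scl A (W_bracket scl A X Y) Z +
      fscl scl (psign (p * q)) (W_bracket scl A Y (W_bracket scl A X Z))"
    using hom_bracket_jacobi[OF X(1) Y Z]
    by (simp only: W_bracket_hom[OF Y Z] W_bracket_hom[OF X(1) Y] W_bracket_hom[OF X(1) Z]
        W_bracket_hom[OF X(1) YZ] W_bracket_hom[OF XY Z] W_bracket_hom[OF Y XZ])
  show "W_bracket scl A X (concat_prod scl A mul Y Z) = concat_prod scl A mul (W_bracket scl A X Y) Z +
      fscl scl (psign (p * q)) (concat_prod scl A mul Y (W_bracket scl A X Z))"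
    using hom_bracket_leibniz[OF X(1) Y Z X(2)]
    by (simp only: W_bracket_hom[OF X(1) Y] W_bracket_hom[OF X(1) Z] concat_prod_hom[OF W(2) Z]
        W_bracket_hom[OF X(1) C.shuffle_prod_H[OF Y Z]] concat_prod_hom[OF H_W[OF XY] Z]
            concat_prod_hom[OF W(2) XZ])
qed

end

theorem proposition3p10:
  fixes scl :: "'f::field_char_0 \<Rightarrow> 'a::ab_group_add \<Rightarrow> 'a"
    and A :: "bit \<Rightarrow> 'a set"
    and mul :: "'a \<Rightarrow> 'a \<Rightarrow> 'a"
  assumes "comm_assoc_superalgebra scl UNIV A mul"
  shows "graded_superspace (fscl scl) (P_space scl A mul) (P_par scl A mul) (P_comp scl A mul) \<and>
    (\<forall>h k. \<forall>X\<in>P_comp scl A mul h. \<forall>Y\<in>P_comp scl A mul k.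
       concat_prod scl A mul X Y \<in> P_comp scl A mul (h + k)) \<and>
    poisson_superalgebra (fscl scl) (P_space scl A mul) (P_par scl A mul)
      (concat_prod scl A mul) (W_bracket scl A)"
proof -
  interpret super_comm_assoc scl A mul
    by standard (rule assms)
  have "P_par scl A mul = (\<lambda>p. H p \<inter> D)" by (rule ext) (rule P_par_eq)
  then show ?thesis
    using P_graded concat_P_comp P_poisson by (simp add: P_space_eq)
qed

end
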